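(* For all integers $j,k,m\ge 0$, the Lie group $\widetilde{SL}_\circ(2,\mathbb R)^j\times ST_\circ(2,\mathbb R)^k\times\mathbb R^m$ acts effectively on every connected manifold of positive dimension.
   Context: $SL(2,\mathbb R)$ is the group of real $2\times 2$ matrices of determinant $1$, $SL_\circ(2,\mathbb R)$ its identity component and $\widetilde{SL}_\circ(2,\mathbb R)$ the universal covering group; $ST(2,\mathbb R)$ is the subgroup of upper triangular matrices in $SL(2,\mathbb R)$ and $ST_\circ(2,\mathbb R)$ its identity component. $G^k$ is the $k$-fold direct product. An action $(\alpha,G,M)$ of a Lie group $G$ on a manifold $M$ is a homomorphism $g\mapsto g^\alpha$ from $G$ to the group of homeomorphisms of $M$ such that the evaluation map $G\times M\to M$, $(g,x)\mapsto g^\alpha(x)$, is continuous; it is effective if the homomorphism is injective. *)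

theory Defs
  imports "HOL-Analysis.Analysis" "HOL-Algebra.Group"
begin

definition SL2 :: "(real^2^2) set" where
  "SL2 = {A. det A = 1}"

definition SL2_0 :: "(real^2^2) set" where
  "SL2_0 = connected_component_set SL2 (mat 1)"

definition ST2 :: "(real^2^2) set" where
  "ST2 = {A. det A = 1 \<and> A $ 2 $ 1 = 0}"

definition ST2_0 :: "(real^2^2) set" where
  "ST2_0 = connected_component_set ST2 (mat 1)"

text \<open>A group G (HOL-Algebra) whose carrier is a subset of a topological type, such that
  multiplication and inversion are continuous (a topological group), which is path connected
  and simply connected, together with a continuous homomorphism p onto SL_0(2,R) which is a
  covering map. Such a pair is the universal covering group (unique up to isomorphism).\<close>
definition is_universal_cover_SL2 :: "('g::topological_space) monoid \<Rightarrow> ('g \<Rightarrow> real^2^2) \<Rightarrow> bool" where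
  "is_universal_cover_SL2 G p \<longleftrightarrow>
     group G \<and>
     continuous_on (carrier G \<times> carrier G) (\<lambda>(a,b). a \<otimes>\<^bsub>G\<^esub> b) \<and>
     continuous_on (carrier G) (\<lambda>a. inv\<^bsub>G\<^esub> a) \<and>
     path_connected (carrier G) \<and> simply_connected (carrier G) \<and>
     (\<forall>a\<in>carrier G. \<forall>b\<in>carrier G. p (a \<otimes>\<^bsub>G\<^esub> b) = p a ** p b) \<and>
     covering_space (carrier G) p SL2_0"

type_synonym ('g) prodelt = "(nat \<Rightarrow> 'g) \<times> (nat \<Rightarrow> real^2^2) \<times> (nat \<Rightarrow> real)"

definition prod_carrier :: "'g monoid \<Rightarrow> nat \<Rightarrow> nat \<Rightarrow> nat \<Rightarrow> 'g prodelt set" where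
  "prod_carrier G j k m =
     (PiE {..<j} (\<lambda>_. carrier G)) \<times> (PiE {..<k} (\<lambda>_. ST2_0)) \<times> (PiE {..<m} (\<lambda>_. UNIV))"

definition prod_topo :: "('g::topological_space) monoid \<Rightarrow> nat \<Rightarrow> nat \<Rightarrow> nat \<Rightarrow> 'g prodelt topology" where
  "prod_topo G j k m =
     prod_topology (product_topology (\<lambda>_. top_of_set (carrier G)) {..<j})
       (prod_topology (product_topology (\<lambda>_. top_of_set ST2_0) {..<k})
          (product_topology (\<lambda>_. euclideanreal) {..<m}))"

definition prod_mult :: "'g monoid \<Rightarrow> nat \<Rightarrow> nat \<Rightarrow> nat \<Rightarrow> 'g prodelt \<Rightarrow> 'g prodelt \<Rightarrow> 'g prodelt" where
  "prod_mult G j k m x y =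
     (case x of (u, v, w) \<Rightarrow> case y of (u', v', w') \<Rightarrow>
       (\<lambda>i\<in>{..<j}. u i \<otimes>\<^bsub>G\<^esub> u' i, \<lambda>i\<in>{..<k}. v i ** v' i, \<lambda>i\<in>{..<m}. w i + w' i))"

definition manifold_of_dim :: "'a topology \<Rightarrow> nat \<Rightarrow> bool" where
  "manifold_of_dim X n \<longleftrightarrow>
     Hausdorff_space X \<and> second_countable X \<and>
     (\<forall>x\<in>topspace X. \<exists>U V. openin X U \<and> x \<in> U \<and> openin (Euclidean_space n) V \<and>
         subtopology X U homeomorphic_space subtopology (Euclidean_space n) V)"

definition effective_action ::
  "'g set \<Rightarrow> ('g \<Rightarrow> 'g \<Rightarrow> 'g) \<Rightarrow> 'g topology \<Rightarrow> 'a topology \<Rightarrow> ('g \<Rightarrow> 'a \<Rightarrow> 'a) \<Rightarrow> bool" where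
  "effective_action C mul T X \<alpha> \<longleftrightarrow>
     (\<forall>g\<in>C. homeomorphic_map X X (\<alpha> g)) \<and>
     (\<forall>g\<in>C. \<forall>h\<in>C. \<forall>x\<in>topspace X. \<alpha> (mul g h) x = \<alpha> g (\<alpha> h x)) \<and>
     continuous_map (prod_topology T X) X (\<lambda>(g, x). \<alpha> g x) \<and>
     (\<forall>g\<in>C. \<forall>h\<in>C. g \<noteq> h \<longrightarrow> (\<exists>x\<in>topspace X. \<alpha> g x \<noteq> \<alpha> h x))"

end

theory Submission
  imports Defs "HOL-Complex_Analysis.Winding_Numbers"
begin

text \<open>Each factor of the group acts faithfully on the real line by increasing homeomorphisms: the reals
  by translations, the upper triangular group by affine maps, and the universal cover of
  \<open>SL(2,R)\<close> by lifting the action of \<open>SL(2,R)\<close> on the circle of directions. Conjugating the line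
  to an open interval and extending by the identity, the factors act on pairwise disjoint
  intervals of a half-line, hence commute, and their product acts faithfully with support in a compact
  interval of positive radii. Applied to the radius this gives an action on a ball in a chart of the
  manifold which is trivial near the boundary and extends by the identity.

  To lift the circle action, the universal cover is given global coordinates: the three
  one-parameter subgroups of the Iwasawa decomposition lift through the covering, and the product
  of their lifts is a homeomorphism from a three-dimensional vector space.\<close>

subsection \<open>Monotone actions on the line\<close>

text \<open>Passing to the universal cover is what makes a line action of the first factor possible:
  \<open>SL(2,R)\<close> has elements of finite order, and an increasing homeomorphism of the line
  of finite order is the identity, whereas in the cover a full turn becomes a translation by
  \<open>2 * pi\<close>. The radii run from 1 to 1 plus the number of factors because every factor
  receives one interval of length 1, while a ball of radius 1 is left fixed at the centre, where
  scaling by a quotient of radii would be singular. Actions are recorded through a multiplication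
  and a named inverse map \<open>\<nu>\<close>, so the product never has to be set up as a
  group.\<close>

definition monotone_action ::
  "'g topology \<Rightarrow> ('g \<Rightarrow> 'g \<Rightarrow> 'g) \<Rightarrow> ('g \<Rightarrow> 'g) \<Rightarrow> ('g \<Rightarrow> real \<Rightarrow> real) \<Rightarrow> bool" where
  "monotone_action T mul \<nu> F \<longleftrightarrow>
     (\<forall>g\<in>topspace T. \<forall>h\<in>topspace T. \<forall>t. F (mul g h) t = F g (F h t)) \<and>
     (\<forall>g\<in>topspace T. \<nu> g \<in> topspace T \<and> (\<forall>t. F g (F (\<nu> g) t) = t \<and> F (\<nu> g) (F g t) = t)) \<and>
     (\<forall>t. continuous_map T euclideanreal (\<lambda>g. F g t)) \<and>
     (\<forall>g\<in>topspace T. strict_mono (F g))"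

lemma
  assumes "monotone_action T mul \<nu> F"
  shows monotone_action_mult:
      "\<And>g h t. g \<in> topspace T \<Longrightarrow> h \<in> topspace T \<Longrightarrow> F (mul g h) t = F g (F h t)"
    and monotone_action_inv: "\<And>g. g \<in> topspace T \<Longrightarrow> \<nu> g \<in> topspace T"
      "\<And>g t. g \<in> topspace T \<Longrightarrow> F g (F (\<nu> g) t) = t"
      "\<And>g t. g \<in> topspace T \<Longrightarrow> F (\<nu> g) (F g t) = t"
    and monotone_action_orbit: "\<And>t. continuous_map T euclideanreal (\<lambda>g. F g t)"
    and monotone_action_mono: "\<And>g. g \<in> topspace T \<Longrightarrow> strict_mono (F g)"
  using assms by (auto simp: monotone_action_def)

text \<open>By monotonicity a strict bound for \<^term>\<open>F g t\<close> can be checked at a single nearby point \<open>s\<close>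
  in place of \<open>t\<close>, so continuity of the orbit maps suffices; no separate argument is needed
  at the fixed end points of an interval on which an action is supported.\<close>
lemma monotone_action_jointly_continuous:
  assumes "monotone_action T mul \<nu> F"
  shows "continuous_map (prod_topology T euclideanreal) euclideanreal (\<lambda>(g,t). F g t)"
proof -
  note act = monotone_action_inv [OF assms] monotone_action_orbit [OF assms]
    monotone_action_mono [OF assms, THEN strict_mono_less]
  let ?P = "prod_topology T euclideanreal"
  have upper: "openin ?P {x \<in> topspace ?P. (case x of (g,t) \<Rightarrow> F g t) > a}" (is "openin _ (?S a)") for a
  proof (subst openin_subopen, intro ballI)
    fix x assume "x \<in> ?S a"
    then obtain g0 t0 where x: "x = (g0,t0)" and g0: "g0 \<in> topspace T" and a: "a < F g0 t0"
      by (cases x) auto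
    obtain b where b: "a < b" "b < F g0 t0" using dense a by blast
    \<comment> \<open>The point that \<open>F g0\<close> carries to \<open>b\<close>, hence to the
      left of \<open>t0\<close>; a bound at \<open>s\<close> passes to all points right of
      \<open>s\<close>.\<close>
    define s where "s = F (\<nu> g0) b"
    have s: "F g0 s = b" "s < t0" using act b g0 unfolding s_def by metis+
    let ?U = "{g \<in> topspace T. F g s \<in> {a<..}} \<times> {s<..}"
    have "openin T {g \<in> topspace T. F g s \<in> {a<..}}"
      by (rule openin_continuous_map_preimage [OF act(4)]) simp
    then have "openin ?P ?U" by (simp add: openin_prod_Times_iff)
    moreover have "(g0,t0) \<in> ?U" using g0 s b by auto
    moreover have "a < F g t" if "g \<in> topspace T" "a < F g s" "s < t" for g t
      using act(5)[OF that(1), of s t] that by linarith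
    ultimately show "\<exists>U. openin ?P U \<and> x \<in> U \<and> U \<subseteq> ?S a"
      using x by (intro exI[of _ ?U]) auto
  qed
  have lower: "openin ?P {x \<in> topspace ?P. (case x of (g,t) \<Rightarrow> F g t) < a}" (is "openin _ (?S a)") for a
  proof (subst openin_subopen, intro ballI)
    fix x assume "x \<in> ?S a"
    then obtain g0 t0 where x: "x = (g0,t0)" and g0: "g0 \<in> topspace T" and a: "F g0 t0 < a"
      by (cases x) auto
    obtain b where b: "b < a" "F g0 t0 < b" using dense a by blast
    define s where "s = F (\<nu> g0) b"
    have s: "F g0 s = b" "t0 < s" using act b g0 unfolding s_def by metis+
    let ?U = "{g \<in> topspace T. F g s \<in> {..<a}} \<times> {..<s}"
    have "openin T {g \<in> topspace T. F g s \<in> {..<a}}"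
      by (rule openin_continuous_map_preimage [OF act(4)]) simp
    then have "openin ?P ?U" by (simp add: openin_prod_Times_iff)
    moreover have "(g0,t0) \<in> ?U" using g0 s b by auto
    moreover have "F g t < a" if "g \<in> topspace T" "F g s < a" "t < s" for g t
      using act(5)[OF that(1), of t s] that by linarith
    ultimately show "\<exists>U. openin ?P U \<and> x \<in> U \<and> U \<subseteq> ?S a"
      using x by (intro exI[of _ ?U]) auto
  qed
  show ?thesis
    unfolding continuous_map_upper_lower_semicontinuous_lt using upper lower by blast
qed

text \<open>For fixed \<open>s < t\<close> the difference \<open>F g t - F g s\<close> is a
  continuous function of \<open>g\<close> on a connected space. It is positive at the identity and,
  by injectivity, has no zero. Monotonicity of the lifted circle action comes from this, with no
  computation of angles.\<close>

lemma strict_mono_by_connectedness: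
  assumes conn: "connected_space T" and e: "e \<in> topspace T" "\<And>t. F e t = t"
    and orbit: "\<And>t. continuous_map T euclideanreal (\<lambda>g. F g t)"
    and inj: "\<And>g. g \<in> topspace T \<Longrightarrow> inj (F g)"
    and g: "g \<in> topspace T"
  shows "strict_mono (F g)"
proof (rule strict_monoI, rule ccontr)
  fix s t :: real assume st: "s < t" and "\<not> F g s < F g t"
  let ?f = "\<lambda>g. F g t - F g s"
  have "connectedin euclideanreal (?f ` topspace T)"
    by (rule connectedin_continuous_map_image [where X=T])
       (use conn orbit in \<open>auto intro: continuous_intros simp: connectedin_topspace\<close>)
  moreover have "t - s \<in> ?f ` topspace T" by (rule image_eqI[OF _ e(1)]) (simp add: e(2))
  moreover have "F g t - F g s \<in> ?f ` topspace T" using g by blast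
  ultimately have "0 \<in> ?f ` topspace T"
    using \<open>\<not> F g s < F g t\<close> st connected_contains_Icc[of "?f ` topspace T" "F g t - F g s" "t - s"]
    by (simp add: subset_iff)
  then obtain h where "h \<in> topspace T" "F h t = F h s" by auto
  then show False using inj[of h] st by (auto dest: injD)
qed

section \<open>Conjugation into the unit interval and stacking of actions\<close>

definition supported_in :: "'g set \<Rightarrow> ('g \<Rightarrow> real \<Rightarrow> real) \<Rightarrow> real set \<Rightarrow> bool" where
  "supported_in C F S \<longleftrightarrow> (\<forall>g\<in>C. \<forall>t. t \<notin> S \<longrightarrow> F g t = t)"

text \<open>The map \<open>s -> tan (pi * (s - 1/2))\<close> is an increasing homeomorphism of the
  open unit interval onto the line, with inverse \<open>1/2 + arctan t / pi\<close>.\<close>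

definition on_unit_interval :: "('g \<Rightarrow> real \<Rightarrow> real) \<Rightarrow> 'g \<Rightarrow> real \<Rightarrow> real" where
  "on_unit_interval F g s =
    (if 0 < s \<and> s < 1 then 1/2 + arctan (F g (tan (pi * (s - 1/2)))) / pi else s)"

lemma arctan_unit_interval:
  "0 < 1/2 + arctan x / pi" "1/2 + arctan x / pi < 1"
proof -
  have "- (1/2) < arctan x / pi" using arctan_lbound[of x] by (simp add: less_divide_eq)
  then show "0 < 1/2 + arctan x / pi" by simp
  show "1/2 + arctan x / pi < 1" using arctan_ubound[of x] by (simp add: field_simps)
qed

lemma arctan_tan_unit_interval:
  assumes "0 < s" "s < (1::real)"
  shows "1/2 + arctan (tan (pi * (s - 1/2))) / pi = s"
proof -
  have "pi * s < pi * 1" "0 < pi * s" using assms by (simp_all add: mult_less_cancel_left_pos)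
  then have "arctan (tan (pi * (s - 1/2))) = pi * (s - 1/2)"
    by (intro arctan_tan) (simp_all add: algebra_simps)
  then show ?thesis by simp
qed

lemma on_unit_interval_arctan:
  "on_unit_interval F g (1/2 + arctan t / pi) = 1/2 + arctan (F g t) / pi"
  using arctan_unit_interval [of t] by (simp add: on_unit_interval_def tan_arctan)

text \<open>Meant as a case rule: an interior point given by its coordinate \<open>t\<close> turns a
  claim on the conjugated action into the claim on \<open>F\<close> at \<open>t\<close>.\<close>

lemma unit_interval_cases:
  fixes s :: real
  obtains t where "s = 1/2 + arctan t / pi" | "s \<le> 0 \<or> 1 \<le> s"
  using arctan_tan_unit_interval by (metis not_le)

lemma on_unit_interval_outside: "s \<le> 0 \<or> 1 \<le> s \<Longrightarrow> on_unit_interval F g s = s"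
  by (auto simp: on_unit_interval_def)

lemma monotone_action_on_unit_interval:
  assumes "monotone_action T mul \<nu> F"
  shows "monotone_action T mul \<nu> (on_unit_interval F)"
proof -
  note act = monotone_action_inv [OF assms] monotone_action_orbit [OF assms]
    monotone_action_mono [OF assms] monotone_action_mult [OF assms]
  note oi = on_unit_interval_arctan on_unit_interval_outside
  have "on_unit_interval F (mul g h) s = on_unit_interval F g (on_unit_interval F h s)"
    if "g \<in> topspace T" "h \<in> topspace T" for g h s
    by (cases s rule: unit_interval_cases) (use that act in \<open>simp_all add: oi\<close>)
  moreover have "on_unit_interval F g (on_unit_interval F (\<nu> g) s) = s \<and>
      on_unit_interval F (\<nu> g) (on_unit_interval F g s) = s" if "g \<in> topspace T" for g s
    by (cases s rule: unit_interval_cases) (use that act in \<open>simp_all add: oi\<close>)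
  moreover have "continuous_map T euclideanreal (\<lambda>g. on_unit_interval F g s)" for s
  proof (cases s rule: unit_interval_cases)
    case (1 t)
    have "continuous_map euclideanreal euclideanreal (\<lambda>x. 1/2 + arctan x / pi)"
      by (auto intro!: continuous_intros)
    from continuous_map_compose [OF act(4)[of t] this] show ?thesis
      by (simp add: 1 oi o_def)
  qed (simp add: oi)
  \<comment> \<open>If only one of the two points is interior, the other is fixed and the interior
    one stays inside the interval, so the bounds on \<open>arctan\<close> decide.\<close>
  moreover have "on_unit_interval F g s < on_unit_interval F g s'"
    if "g \<in> topspace T" "s < s'" for g s s'
  proof -
    note F = strict_mono_less[OF act(5)[OF that(1)]]
    note bounds = arctan_unit_interval
    show ?thesis
    proof (cases s rule: unit_interval_cases)
      case (1 t)
      note s = this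
      show ?thesis
      proof (cases s' rule: unit_interval_cases)
        case (1 t')
        then show ?thesis
          using s that F by (simp add: oi arctan_less_iff divide_less_cancel)
      next
        case 2
        then show ?thesis
          using s that bounds[of t] bounds[of "F g t"] by (simp add: oi)
      qed
    next
      case 2
      note s = this
      show ?thesis
      proof (cases s' rule: unit_interval_cases)
        case (1 t')
        then show ?thesis
          using s that bounds[of t'] bounds[of "F g t'"] by (simp add: oi)
      next
        case 2
        then show ?thesis
          using s that by (simp add: oi)
      qed
    qed
  qed
  ultimately show ?thesis
    using act(1) unfolding monotone_action_def strict_mono_def by blast
qed

lemma on_unit_interval_eqD:
  assumes "\<And>s. on_unit_interval F g s = on_unit_interval F h s"
  shows "F g t = F h t"
  using assms [of "1/2 + arctan t / pi"] by (simp add: on_unit_interval_arctan arctan_eq_iff)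

text \<open>The \<open>i\<close>-th action is placed on \<open>[1 + i, 2 + i]\<close>; at every point at most one summand is
  nonzero, and writing the result as a sum makes its continuity immediate.\<close>
definition stacked :: "nat \<Rightarrow> (nat \<Rightarrow> 'g \<Rightarrow> real \<Rightarrow> real) \<Rightarrow> 'g \<Rightarrow> real \<Rightarrow> real" where
  "stacked N A g r = r + (\<Sum>i<N. A i g (r - 1 - real i) - (r - 1 - real i))"

text \<open>The end points of the closed interval lie outside all the open supports, so adjacent
  blocks agree there and weak inequalities suffice.\<close>

lemma stacked_on_interval:
  assumes supp: "\<And>i. i < N \<Longrightarrow> supported_in C (A i) {0<..<1}" and g: "g \<in> C"
    and i: "i < N" and r: "1 + real i \<le> r" "r \<le> 2 + real i"
  shows "stacked N A g r = 1 + real i + A i g (r - 1 - real i)"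
proof -
  have "A j g (r - 1 - real j) - (r - 1 - real j) =
      (if j = i then A i g (r - 1 - real i) - (r - 1 - real i) else 0)" if "j < N" for j
  proof (cases "j = i")
    case False
    then have "real j + 1 \<le> real i \<or> real i + 1 \<le> real j" by linarith
    then have "r - 1 - real j \<notin> {0<..<1}" using r by auto
    then show ?thesis using supp[OF that] g False by (simp add: supported_in_def)
  qed simp
  then have "(\<Sum>j<N. A j g (r - 1 - real j) - (r - 1 - real j)) =
      (\<Sum>j<N. if j = i then A i g (r - 1 - real i) - (r - 1 - real i) else 0)"
    by (intro sum.cong) auto
  then show ?thesis using i by (simp add: stacked_def)
qed

lemma stacked_outside:
  assumes supp: "\<And>i. i < N \<Longrightarrow> supported_in C (A i) {0<..<1}" and g: "g \<in> C"
    and r: "r \<le> 1 \<or> 1 + real N \<le> r"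
  shows "stacked N A g r = r"
proof -
  have "A j g (r - 1 - real j) - (r - 1 - real j) = 0" if "j < N" for j
  proof -
    have "real j + 1 \<le> real N" using that by linarith
    then have "r - 1 - real j \<notin> {0<..<1}" using r by auto
    then show ?thesis using supp[OF that] g by (simp add: supported_in_def)
  qed
  then show ?thesis by (simp add: stacked_def)
qed

lemma stacked_cases:
  fixes r :: real
  obtains "r \<le> 1 \<or> 1 + real N \<le> r" | i where "i < N" "1 + real i \<le> r" "r \<le> 2 + real i"
proof (cases "r \<le> 1 \<or> 1 + real N \<le> r")
  case False
  then have r: "0 < r - 1" "r - 1 < real N" by auto
  define i where "i = nat \<lfloor>r - 1\<rfloor>"
  have i: "real i = of_int \<lfloor>r - 1\<rfloor>" using r by (simp add: i_def)
  have "real i \<le> r - 1" "r - 1 < real i + 1" unfolding i by linarith+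
  then have "i < N" "1 + real i \<le> r" "r \<le> 2 + real i" using r by linarith+
  then show ?thesis by (rule that(2))
qed (rule that(1))

text \<open>Both end points are fixed and the maps are monotone.\<close>

lemma supported_unit_interval_invariant:
  assumes "monotone_action T mul \<nu> A" "supported_in (topspace T) A {0<..<1}"
    and g: "g \<in> topspace T" and s: "0 \<le> s" "s \<le> 1"
  shows "0 \<le> A g s" "A g s \<le> 1"
proof -
  have "A g 0 = 0" "A g 1 = 1" using assms by (auto simp: supported_in_def)
  moreover have "mono (A g)" by (rule strict_mono_mono[OF monotone_action_mono[OF assms(1) g]])
  ultimately show "0 \<le> A g s" "A g s \<le> 1" using s by (metis monoD)+
qed

text \<open>Every block \<open>[1 + i, 2 + i]\<close> is invariant, so a composition is evaluated
  inside one block, where it is the composition in the \<open>i\<close>-th action alone.\<close>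

lemma
  assumes A: "\<And>i. i < N \<Longrightarrow> monotone_action T mul \<nu> (A i)"
    and supp: "\<And>i. i < N \<Longrightarrow> supported_in (topspace T) (A i) {0<..<1}"
  shows stacked_mult: "\<lbrakk>g \<in> topspace T; h \<in> topspace T; mul g h \<in> topspace T\<rbrakk> \<Longrightarrow>
      stacked N A (mul g h) r = stacked N A g (stacked N A h r)"
    and stacked_inv: "g \<in> topspace T \<Longrightarrow> \<nu> g \<in> topspace T \<Longrightarrow>
      stacked N A g (stacked N A (\<nu> g) r) = r \<and> stacked N A (\<nu> g) (stacked N A g r) = r"
proof -
  have out: "stacked N A g r = r" if "g \<in> topspace T" "r \<le> 1 \<or> 1 + real N \<le> r" for g r
    using supp that by (rule stacked_outside)
  have on: "stacked N A g r = 1 + real i + A i g (r - 1 - real i)"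
    if "g \<in> topspace T" "i < N" "1 + real i \<le> r" "r \<le> 2 + real i" for g i r
    using supp that by (rule stacked_on_interval)
  have invariant: "1 + real i \<le> stacked N A g r \<and> stacked N A g r \<le> 2 + real i"
    if "g \<in> topspace T" "i < N" "1 + real i \<le> r" "r \<le> 2 + real i" for g i r
    using supported_unit_interval_invariant[OF A supp, of i g "r - 1 - real i"] on[of g i r] that
    by simp
  show "stacked N A (mul g h) r = stacked N A g (stacked N A h r)"
    if "g \<in> topspace T" "h \<in> topspace T" "mul g h \<in> topspace T"
  proof (cases r rule: stacked_cases[where N=N])
    case 1
    then show ?thesis using that by (simp add: out)
  next
    case (2 i)
    then show ?thesis
      using that invariant[of h i r] on[of g i "stacked N A h r"]
      by (simp add: on monotone_action_mult[OF A])
  qed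
  show "stacked N A g (stacked N A (\<nu> g) r) = r \<and> stacked N A (\<nu> g) (stacked N A g r) = r"
    if "g \<in> topspace T" "\<nu> g \<in> topspace T"
  proof (cases r rule: stacked_cases[where N=N])
    case 1
    then show ?thesis using that by (simp add: out)
  next
    case (2 i)
    then show ?thesis
      using that invariant[of g i r] invariant[of "\<nu> g" i r] on[of g i "stacked N A (\<nu> g) r"]
        on[of "\<nu> g" i "stacked N A g r"]
      by (simp add: on monotone_action_inv[OF A])
  qed
qed

lemma stacked_jointly_continuous:
  assumes "\<And>i. i < N \<Longrightarrow> monotone_action T mul \<nu> (A i)"
  shows "continuous_map (prod_topology T euclideanreal) euclideanreal (\<lambda>(g,r). stacked N A g r)"
proof -
  let ?P = "prod_topology T euclideanreal"
  have "continuous_map ?P euclideanreal (\<lambda>x. A i (fst x) (snd x - 1 - real i))" if "i < N" for i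
  proof -
    have "continuous_map ?P ?P (\<lambda>x. (fst x, snd x - 1 - real i))"
      by (intro continuous_map_pairedI continuous_intros continuous_map_fst continuous_map_snd) auto
    from continuous_map_compose[OF this monotone_action_jointly_continuous[OF assms[OF that]]]
    show ?thesis by (simp add: o_def)
  qed
  then have "continuous_map ?P euclideanreal (\<lambda>x. stacked N A (fst x) (snd x))"
    unfolding stacked_def
    by (intro continuous_intros continuous_map_snd) auto
  then show ?thesis by (simp add: case_prod_unfold)
qed

lemma stacked_eqD:
  assumes supp: "\<And>i. i < N \<Longrightarrow> supported_in C (A i) {0<..<1}" and "g \<in> C" "h \<in> C"
    and eq: "\<And>r. stacked N A g r = stacked N A h r" and i: "i < N"
  shows "A i g s = A i h s"
proof (cases "0 < s \<and> s < 1")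
  case True
  then show ?thesis
    using eq[of "1 + real i + s"]
      stacked_on_interval[of N C A g i "1 + real i + s"]
      stacked_on_interval[of N C A h i "1 + real i + s"] assms
    by simp
next
  case False
  then show ?thesis using supp[OF i] assms by (simp add: supported_in_def)
qed

subsection \<open>Radial actions on manifolds\<close>

text \<open>In a Hausdorff space the compact set carrying the action is closed, so its complement
  and the chart domain form an open cover; on the overlap both formulas are the identity. The map
  \<open>\<nu>\<close> supplies the inverse homeomorphisms.\<close>

lemma effective_action_extend_by_identity:
  assumes X: "Hausdorff_space X" and U: "openin X U"
    and ff': "homeomorphic_maps (subtopology X U) Y f f'"
    and \<beta>: "effective_action (topspace T) mul T Y \<beta>"
    and K: "compactin Y K"
    and off: "\<And>g y. \<lbrakk>g \<in> topspace T; y \<in> topspace Y - K\<rbrakk> \<Longrightarrow> \<beta> g y = y"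
    and \<nu>: "\<And>g. g \<in> topspace T \<Longrightarrow> \<nu> g \<in> topspace T"
      "\<And>g y. \<lbrakk>g \<in> topspace T; y \<in> topspace Y\<rbrakk> \<Longrightarrow> \<beta> g (\<beta> (\<nu> g) y) = y \<and> \<beta> (\<nu> g) (\<beta> g y) = y"
  shows "\<exists>\<alpha>. effective_action (topspace T) mul T X \<alpha>"
proof -
  have \<beta>hom: "\<beta> (mul g h) y = \<beta> g (\<beta> h y)"
    if "g \<in> topspace T" "h \<in> topspace T" "y \<in> topspace Y" for g h y
    using \<beta> that by (auto simp: effective_action_def)
  have \<beta>cont: "continuous_map (prod_topology T Y) Y (\<lambda>(g,y). \<beta> g y)"
    using \<beta> by (auto simp: effective_action_def)
  have \<beta>Y: "\<beta> g y \<in> topspace Y" if "g \<in> topspace T" "y \<in> topspace Y" for g y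
    using continuous_map_image_subset_topspace[OF \<beta>cont] that by fastforce
  have UX: "U \<subseteq> topspace X" using U openin_subset by blast
  have f: "continuous_map (subtopology X U) Y f" and f': "continuous_map Y (subtopology X U) f'"
    using ff' by (auto simp: homeomorphic_maps_def)
  have f'f: "f' (f x) = x" "f x \<in> topspace Y" if "x \<in> U" for x
    using ff' that UX continuous_map_image_subset_topspace[OF f]
    by (auto simp: homeomorphic_maps_def)
  have f'U: "f (f' y) = y" "f' y \<in> U" if "y \<in> topspace Y" for y
    using ff' that UX continuous_map_image_subset_topspace[OF f']
    by (auto simp: homeomorphic_maps_def)
  define \<alpha> where "\<alpha> = (\<lambda>g x. if x \<in> U then f' (\<beta> g (f x)) else x)"
  have \<alpha>X: "\<alpha> g x \<in> topspace X" if "g \<in> topspace T" "x \<in> topspace X" for g x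
    using that f'U(2)[OF \<beta>Y] f'f UX by (auto simp: \<alpha>_def)
  have comp: "\<alpha> g (\<alpha> h x) = (if x \<in> U then f' (\<beta> g (\<beta> h (f x))) else x)"
    if "g \<in> topspace T" "h \<in> topspace T" for g h x
    using that f'U[OF \<beta>Y] f'f by (auto simp: \<alpha>_def)
  have cont: "continuous_map (prod_topology T X) X (\<lambda>(g,x). \<alpha> g x)"
  proof (rule pasting_lemma[where I = "{True,False}"
      and T = "\<lambda>b. if b then topspace T \<times> U else topspace T \<times> (topspace X - f' ` K)"
      and f = "\<lambda>b. if b then (\<lambda>(g,x). f' (\<beta> g (f x))) else snd"])
    have "compactin (subtopology X U) (f' ` K)" by (rule image_compactin[OF K f'])
    then have "closedin X (f' ` K)"
      using X compactin_imp_closedin compactin_subtopology by blast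
    then show "openin (prod_topology T X)
        (if b then topspace T \<times> U else topspace T \<times> (topspace X - f' ` K))" for b
      using U by (simp add: openin_prod_Times_iff openin_diff)
    let ?S = "prod_topology T (subtopology X U)"
    have "continuous_map ?S (prod_topology T Y) (\<lambda>z. (fst z, f (snd z)))"
      using continuous_map_compose[OF continuous_map_snd f]
      by (intro continuous_map_pairedI continuous_map_fst) (simp add: o_def)
    from continuous_map_compose[OF continuous_map_compose[OF this \<beta>cont] f']
    have "continuous_map ?S X (\<lambda>(g,x). f' (\<beta> g (f x)))"
      by (simp add: o_def case_prod_unfold continuous_map_in_subtopology)
    moreover have "subtopology (prod_topology T X) (topspace T \<times> U) = ?S"
      by (simp add: prod_topology_subtopology)
    ultimately show "continuous_map (subtopology (prod_topology T X)
        (if b then topspace T \<times> U else topspace T \<times> (topspace X - f' ` K))) X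
        (if b then \<lambda>(g,x). f' (\<beta> g (f x)) else snd)" for b
      by (simp add: continuous_map_from_subtopology continuous_map_snd)
    have overlap: "f' (\<beta> g (f x)) = x" if "g \<in> topspace T" "x \<in> U" "x \<notin> f' ` K" for g x
    proof -
      have "f x \<notin> K" using that f'f by (metis imageI)
      then show ?thesis using that off f'f by simp
    qed
    show "(if i then \<lambda>(g,x). f' (\<beta> g (f x)) else snd) z = (if j then \<lambda>(g,x). f' (\<beta> g (f x)) else snd) z"
      if "z \<in> topspace (prod_topology T X) \<inter> 
            (if i then topspace T \<times> U else topspace T \<times> (topspace X - f' ` K)) \<inter>
            (if j then topspace T \<times> U else topspace T \<times> (topspace X - f' ` K))" for i j z
      using that overlap by (auto split: if_splits)
    have "f' ` K \<subseteq> U" using f'U(2) compactin_subset_topspace[OF K] by blast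
    then show "\<exists>j. j \<in> {True, False} \<and> 
        z \<in> (if j then topspace T \<times> U else topspace T \<times> (topspace X - f' ` K)) \<and>
        (case z of (g,x) \<Rightarrow> \<alpha> g x) = (if j then \<lambda>(g,x). f' (\<beta> g (f x)) else snd) z"
      if "z \<in> topspace (prod_topology T X)" for z
      using that by (intro exI[of _ "snd z \<in> U"]) (auto simp: \<alpha>_def)
  qed
  have \<alpha>cont: "continuous_map X X (\<alpha> g)" if "g \<in> topspace T" for g
  proof -
    have "continuous_map X (prod_topology T X) (\<lambda>x. (g, x))"
      using that by (intro continuous_map_pairedI) auto
    from continuous_map_compose[OF this cont] show ?thesis by (simp add: o_def)
  qed
  have inv: "\<alpha> g (\<alpha> (\<nu> g) x) = x" "\<alpha> (\<nu> g) (\<alpha> g x) = x" if "g \<in> topspace T" for g x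
    using comp[of g "\<nu> g"] comp[of "\<nu> g" g] \<nu> that f'f by auto
  have "effective_action (topspace T) mul T X \<alpha>"
    unfolding effective_action_def
  proof (intro conjI ballI impI)
    show "homeomorphic_map X X (\<alpha> g)" if "g \<in> topspace T" for g
      unfolding homeomorphic_map_maps homeomorphic_maps_def
      using that \<alpha>cont inv \<nu>(1) by blast
    show "\<alpha> (mul g h) x = \<alpha> g (\<alpha> h x)" 
      if "g \<in> topspace T" "h \<in> topspace T" "x \<in> topspace X" for g h x
      unfolding comp[OF that(1,2)] using that f'f(2) by (simp add: \<alpha>_def \<beta>hom)
    show "\<exists>x\<in>topspace X. \<alpha> g x \<noteq> \<alpha> h x" if gh: "g \<in> topspace T" "h \<in> topspace T" "g \<noteq> h" for g h
    proof -
      have "\<exists>y\<in>topspace Y. \<beta> g y \<noteq> \<beta> h y"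
        using \<beta> gh unfolding effective_action_def by blast
      then obtain y where y: "y \<in> topspace Y" "\<beta> g y \<noteq> \<beta> h y" by blast
      then have "\<alpha> g (f' y) \<noteq> \<alpha> h (f' y)"
        using f'U[OF y(1)] f'U(1)[OF \<beta>Y[OF gh(1) y(1)]] f'U(1)[OF \<beta>Y[OF gh(2) y(1)]]
        by (auto simp: \<alpha>_def)
      then show ?thesis using f'U(2)[OF y(1)] UX by blast
    qed
  qed (rule cont)
  then show ?thesis by blast
qed

lemma continuous_map_Euclidean_coordinate:
  "continuous_map (Euclidean_space n) euclideanreal (\<lambda>y. y i)"
  unfolding Euclidean_space_def
  by (intro continuous_map_from_subtopology continuous_map_product_coordinates) simp

text \<open>A basic open set of the infinite product restricts finitely many coordinates, so one
  radius below all of theirs works. The closed l1 ball is a closed subset of a product of compact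
  intervals. The l1 norm is a finite sum of continuous functions and is homogeneous, which suits the
  radial action.\<close>

lemma Euclidean_space_compact_ball:
  assumes V: "openin (Euclidean_space n) V" and c: "c \<in> V"
  obtains \<epsilon> where "\<epsilon> > 0"
    "compactin (Euclidean_space n) {y \<in> topspace (Euclidean_space n). (\<Sum>i<n. \<bar>y i - c i\<bar>) \<le> \<epsilon>}"
    "{y \<in> topspace (Euclidean_space n). (\<Sum>i<n. \<bar>y i - c i\<bar>) \<le> \<epsilon>} \<subseteq> V"
proof -
  let ?E = "Euclidean_space n"
  let ?S = "\<lambda>y. \<Sum>i<n. \<bar>y i - c i\<bar> :: real"
  obtain W where W: "openin (powertop_real UNIV) W" "V = W \<inter> topspace ?E"
    using V unfolding Euclidean_space_def openin_subtopology by auto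
  obtain U where U: "finite {i. U i \<noteq> UNIV}" "\<And>i. open (U i)" "c \<in> Pi\<^sub>E UNIV U" "Pi\<^sub>E UNIV U \<subseteq> W"
    using W(1) c W(2) unfolding openin_product_topology_alt by fastforce
  have "\<exists>e>0. ball (c i) e \<subseteq> U i" for i
    using U(2)[of i] U(3) by (metis PiE_mem UNIV_I openE)
  then obtain e where e: "\<And>i. e i > 0" "\<And>i. ball (c i) (e i) \<subseteq> U i" by metis
  \<comment> \<open>Inserting 1 keeps the minimum defined when no coordinate is restricted; halving
    gives the strict bound needed for open balls.\<close>
  define \<epsilon> where "\<epsilon> = Min (insert 1 (e ` {i. U i \<noteq> UNIV})) / 2"
  have "Min (insert 1 (e ` {i. U i \<noteq> UNIV})) > 0" using U(1) e(1) by (subst Min_gr_iff) auto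
  then have \<epsilon>0: "\<epsilon> > 0" by (simp add: \<epsilon>_def)
  have \<epsilon>e: "\<epsilon> < e i" if "U i \<noteq> UNIV" for i
  proof -
    have "Min (insert 1 (e ` {i. U i \<noteq> UNIV})) \<le> e i" using U(1) that by (intro Min_le) auto
    then show ?thesis using \<epsilon>0 unfolding \<epsilon>_def by linarith
  qed
  let ?K = "{y \<in> topspace ?E. ?S y \<le> \<epsilon>}"
  have cE: "c \<in> topspace ?E" using W c by auto
  have coord: "\<bar>y i - c i\<bar> \<le> \<epsilon>" if "y \<in> ?K" for y i
  proof (cases "i < n")
    case True
    then have "\<bar>y i - c i\<bar> \<le> ?S y" by (intro member_le_sum) auto
    then show ?thesis using that by simp
  next
    case False
    then show ?thesis using that cE \<epsilon>0 by (simp add: topspace_Euclidean_space)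
  qed
  have "y i \<in> U i" if "y \<in> ?K" for y i
  proof (cases "U i = UNIV")
    case False
    then have "y i \<in> ball (c i) (e i)"
      using coord[OF that, of i] \<epsilon>e[OF False] by (simp add: dist_real_def abs_minus_commute)
    then show ?thesis using e(2) by blast
  qed simp
  then have KV: "?K \<subseteq> V" using U(4) W(2) by (auto simp: PiE_UNIV_domain)
  have "continuous_map ?E euclideanreal ?S"
    by (intro continuous_intros continuous_map_Euclidean_coordinate) auto
  from closedin_continuous_map_preimage[OF this, of "{..\<epsilon>}"]
  have "closedin ?E ?K" by simp
  then have "closedin (powertop_real UNIV) ?K"
    using closedin_Euclidean_space[of n]
    by (metis (no_types, lifting) Euclidean_space_def closedin_trans_full topspace_Euclidean_space)
  moreover have "compactin (powertop_real UNIV) (Pi\<^sub>E UNIV (\<lambda>i. {c i - \<epsilon>..c i + \<epsilon>}))"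
    by (simp add: compactin_PiE)
  moreover have "?K \<subseteq> Pi\<^sub>E UNIV (\<lambda>i. {c i - \<epsilon>..c i + \<epsilon>})"
    using coord by (fastforce simp: PiE_UNIV_domain abs_le_iff algebra_simps)
  ultimately have "compactin (powertop_real UNIV) ?K" by (meson closed_compactin)
  then have "compactin ?E ?K"
    unfolding Euclidean_space_def by (subst compactin_subtopology) auto
  with \<epsilon>0 KV show ?thesis by (rule_tac that)
qed

text \<open>A point at scaled radius \<open>r\<close> from the centre of a ball is moved along its
  ray to radius \<open>\<Phi> g r\<close>. Radii up to 1 and from \<open>M\<close> on are fixed, so
  the map is the identity near the centre and outside the ball.\<close>

lemma effective_action_on_manifold:
  assumes X: "manifold_of_dim X n" "n \<ge> 1" "topspace X \<noteq> {}"
    and mult: "\<And>g h r. \<lbrakk>g \<in> topspace T; h \<in> topspace T\<rbrakk> \<Longrightarrow> \<Phi> (mul g h) r = \<Phi> g (\<Phi> h r)"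
    and \<nu>: "\<And>g. g \<in> topspace T \<Longrightarrow> \<nu> g \<in> topspace T"
      "\<And>g r. g \<in> topspace T \<Longrightarrow> \<Phi> g (\<Phi> (\<nu> g) r) = r \<and> \<Phi> (\<nu> g) (\<Phi> g r) = r"
    and cont: "continuous_map (prod_topology T euclideanreal) euclideanreal (\<lambda>(g,r). \<Phi> g r)"
    and outside: "\<And>g r. \<lbrakk>g \<in> topspace T; r \<le> 1 \<or> M \<le> r\<rbrakk> \<Longrightarrow> \<Phi> g r = (r::real)"
    and M: "M \<ge> 1"
    and faithful: "\<And>g h. \<lbrakk>g \<in> topspace T; h \<in> topspace T; g \<noteq> h\<rbrakk> \<Longrightarrow> \<exists>r. \<Phi> g r \<noteq> \<Phi> h r"
  shows "\<exists>\<alpha>. effective_action (topspace T) mul T X \<alpha>"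
proof -
  let ?E = "Euclidean_space n"
  \<comment> \<open>A value below 1 would be fixed by the inverse, so \<open>r\<close> itself would
    be below 1.\<close>
  have inside: "1 \<le> \<Phi> g r" if g: "g \<in> topspace T" and r: "1 \<le> r" for g r
  proof (rule ccontr)
    assume "\<not> 1 \<le> \<Phi> g r"
    then have "\<Phi> (\<nu> g) (\<Phi> g r) = \<Phi> g r" using outside \<nu>(1) g by auto
    then show False using \<nu>(2)[OF g, of r] \<open>\<not> 1 \<le> \<Phi> g r\<close> r by auto
  qed
  have below: "\<Phi> g r \<le> M" if g: "g \<in> topspace T" and r: "r \<le> M" for g r
  proof (rule ccontr)
    assume "\<not> \<Phi> g r \<le> M"
    then have "\<Phi> (\<nu> g) (\<Phi> g r) = \<Phi> g r" using outside \<nu>(1) g by auto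
    then show False using \<nu>(2)[OF g, of r] \<open>\<not> \<Phi> g r \<le> M\<close> r by auto
  qed
  obtain x where x: "x \<in> topspace X" using X(3) by blast
  obtain U V where U: "openin X U" "x \<in> U" and V: "openin ?E V"
    and "subtopology X U homeomorphic_space subtopology ?E V"
    using X(1) x unfolding manifold_of_dim_def by blast
  then obtain f f' where ff': "homeomorphic_maps (subtopology X U) (subtopology ?E V) f f'"
    by (auto simp: homeomorphic_space_def)
  define c where "c = f x"
  have c: "c \<in> V"
    using ff' x U(2) continuous_map_image_subset_topspace[of "subtopology X U" "subtopology ?E V" f]
    by (auto simp: c_def homeomorphic_maps_def)
  define S where "S = (\<lambda>y. \<Sum>i<n. \<bar>y i - c i\<bar>)"
  obtain \<epsilon> where \<epsilon>: "\<epsilon> > 0" "compactin ?E {y \<in> topspace ?E. S y \<le> \<epsilon>}"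
      "{y \<in> topspace ?E. S y \<le> \<epsilon>} \<subseteq> V"
    using Euclidean_space_compact_ball[OF V c] unfolding S_def by blast
  \<comment> \<open>The scale makes \<open>M\<close> the radius of the boundary of the compact
    ball.\<close>
  define \<rho> where "\<rho> = (\<lambda>y. M / \<epsilon> * S y)"
  have \<rho>_le: "\<rho> y \<le> M \<longleftrightarrow> S y \<le> \<epsilon>" for y
    using M \<epsilon>(1) by (simp add: \<rho>_def field_simps)
  let ?K = "{y \<in> topspace ?E. S y \<le> \<epsilon>}"
  have VE: "V \<subseteq> topspace ?E" using V openin_subset by blast
  have zero: "y i = 0" if "y \<in> V" "i \<ge> n" for y i
    using that VE by (auto simp: topspace_Euclidean_space)
  \<comment> \<open>the radial action about \<open>c\<close>; the maximum with 1 avoids the division by 0 at the centre\<close>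
  define \<beta> where "\<beta> = (\<lambda>g y i. if i < n then c i + \<Phi> g (max (\<rho> y) 1) / max (\<rho> y) 1 * (y i - c i) else 0)"
  have \<beta>E: "\<beta> g y \<in> topspace ?E" for g y by (simp add: \<beta>_def topspace_Euclidean_space)
  have \<rho>\<beta>: "\<rho> (\<beta> g y) = \<Phi> g (max (\<rho> y) 1) / max (\<rho> y) 1 * \<rho> y" if g: "g \<in> topspace T" for g y
  proof -
    define q where "q = \<Phi> g (max (\<rho> y) 1) / max (\<rho> y) 1"
    have "0 \<le> q" using inside[OF g, of "max (\<rho> y) 1"] by (simp add: q_def)
    moreover have "\<beta> g y i - c i = q * (y i - c i)" if "i < n" for i
      using that by (simp add: \<beta>_def q_def)
    ultimately have "S (\<beta> g y) = q * S y"
      by (simp add: S_def abs_mult sum_distrib_left)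
    then show ?thesis by (simp add: \<rho>_def q_def)
  qed
  \<comment> \<open>The truncated radius transforms exactly by \<open>\<Phi>\<close>, because 1 is a
    fixed radius.\<close>
  have max\<beta>: "max (\<rho> (\<beta> g y)) 1 = \<Phi> g (max (\<rho> y) 1)" if g: "g \<in> topspace T" for g y
  proof (cases "\<rho> y \<le> 1")
    case True
    then show ?thesis using outside[OF g, of 1] by (simp add: \<rho>\<beta>[OF g] max_def)
  next
    case False
    then show ?thesis using inside[OF g, of "\<rho> y"] by (simp add: \<rho>\<beta>[OF g] max_def)
  qed
  \<comment> \<open>The denominator of the second scale factor is the numerator of the first, so the
    product telescopes.\<close>
  have comp: "\<beta> g (\<beta> h y) = 
      (\<lambda>i. if i < n then c i + \<Phi> g (\<Phi> h (max (\<rho> y) 1)) / max (\<rho> y) 1 * (y i - c i) else 0)"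
    if g: "g \<in> topspace T" and h: "h \<in> topspace T" for g h y
  proof -
    have "\<Phi> h (max (\<rho> y) 1) \<noteq> 0" using inside[OF h, of "max (\<rho> y) 1"] by auto
    then have "\<Phi> g (max (\<rho> (\<beta> h y)) 1) / max (\<rho> (\<beta> h y)) 1 * (\<beta> h y i - c i) =
        \<Phi> g (\<Phi> h (max (\<rho> y) 1)) / max (\<rho> y) 1 * (y i - c i)" if "i < n" for i
      unfolding max\<beta>[OF h] using that by (simp add: \<beta>_def)
    moreover have "\<beta> g z =
        (\<lambda>i. if i < n then c i + \<Phi> g (max (\<rho> z) 1) / max (\<rho> z) 1 * (z i - c i) else 0)" for z
      by (simp add: \<beta>_def)
    ultimately show ?thesis by (metis (no_types, lifting))
  qed
  have off: "\<beta> g y = y" if "g \<in> topspace T" "y \<in> topspace (subtopology ?E V) - ?K" for g y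
  proof -
    have "M < \<rho> y" using that VE \<rho>_le[of y] by auto
    then have "\<Phi> g (max (\<rho> y) 1) = max (\<rho> y) 1" "max (\<rho> y) 1 \<noteq> 0" using outside that M by auto
    then show ?thesis using zero[of y] that by (auto simp: \<beta>_def)
  qed
  have \<beta>V: "\<beta> g y \<in> V" if g: "g \<in> topspace T" and y: "y \<in> V" for g y
  proof (cases "y \<in> ?K")
    case True
    then have "\<rho> (\<beta> g y) \<le> M"
      using max\<beta>[OF g, of y] below[OF g, of "max (\<rho> y) 1"] \<rho>_le[of y] M by auto
    then show ?thesis using \<rho>_le[of "\<beta> g y"] \<epsilon>(3) \<beta>E by auto
  next
    case False
    then show ?thesis using off g y VE by auto
  qed
  have \<beta>inv: "\<beta> g (\<beta> (\<nu> g) y) = y \<and> \<beta> (\<nu> g) (\<beta> g y) = y" if "g \<in> topspace T" "y \<in> V" for g y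
  proof -
    have "max (\<rho> y) 1 \<noteq> 0" by auto
    then show ?thesis using that \<nu> comp zero[of y] by auto
  qed
  let ?Y = "subtopology ?E V"
  have \<beta>cont: "continuous_map (prod_topology T ?Y) ?Y (\<lambda>(g,y). \<beta> g y)"
  proof -
    let ?P = "prod_topology T ?Y"
    have coord: "continuous_map ?P euclideanreal (\<lambda>z. snd z i)" for i
      using continuous_map_compose[OF continuous_map_snd
          continuous_map_from_subtopology[OF continuous_map_Euclidean_coordinate]]
      by (simp add: o_def)
    have \<rho>cont: "continuous_map ?P euclideanreal (\<lambda>z. \<rho> (snd z))"
      unfolding \<rho>_def S_def by (intro continuous_intros coord) auto
    have "continuous_map ?P (prod_topology T euclideanreal) (\<lambda>z. (fst z, max (\<rho> (snd z)) 1))"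
      by (intro continuous_map_pairedI continuous_map_fst continuous_map_real_max \<rho>cont) simp
    from continuous_map_compose[OF this cont]
    have \<Phi>cont: "continuous_map ?P euclideanreal (\<lambda>z. \<Phi> (fst z) (max (\<rho> (snd z)) 1))"
      by (simp add: o_def)
    have "continuous_map ?P ?E (\<lambda>z. \<beta> (fst z) (snd z))"
      unfolding \<beta>_def continuous_map_componentwise_Euclidean_space
      by (intro allI impI continuous_intros continuous_map_real_divide continuous_map_real_max 
          \<Phi>cont \<rho>cont coord) auto
    then show ?thesis
      using \<beta>V VE by (auto simp: continuous_map_in_subtopology case_prod_unfold)
  qed
  have \<beta>cont1: "continuous_map ?Y ?Y (\<beta> g)" if "g \<in> topspace T" for g
  proof -
    have "continuous_map ?Y (prod_topology T ?Y) (\<lambda>y. (g, y))"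
      using that by (intro continuous_map_pairedI) auto
    from continuous_map_compose[OF this \<beta>cont] show ?thesis by (simp add: o_def)
  qed
  have "effective_action (topspace T) mul T ?Y \<beta>"
    unfolding effective_action_def
  proof (intro conjI ballI impI)
    show "homeomorphic_map ?Y ?Y (\<beta> g)" if "g \<in> topspace T" for g
    proof -
      have "homeomorphic_maps ?Y ?Y (\<beta> g) (\<beta> (\<nu> g))"
        unfolding homeomorphic_maps_def using that \<beta>cont1 \<beta>inv \<nu>(1) by auto
      then show ?thesis unfolding homeomorphic_map_maps by blast
    qed
    show "\<beta> (mul g h) y = \<beta> g (\<beta> h y)" if "g \<in> topspace T" "h \<in> topspace T" for g h y
      unfolding comp[OF that] by (simp add: \<beta>_def mult[OF that] cong: if_cong)
    show "\<exists>y\<in>topspace ?Y. \<beta> g y \<noteq> \<beta> h y" if gh: "g \<in> topspace T" "h \<in> topspace T" "g \<noteq> h" for g h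
    proof -
      obtain r where r: "\<Phi> g r \<noteq> \<Phi> h r" using faithful gh by blast
      then have r1: "1 < r" "r < M" using outside gh by (metis not_le)+
      \<comment> \<open>The centre is displaced along coordinate 0, which exists because
        \<open>n\<close> is positive, by the amount that gives radius \<open>r\<close>.\<close>
      define y where "y = (\<lambda>i. c i + (if i = 0 then r * \<epsilon> / M else 0))"
      have "S y = (\<Sum>i<n. if i = 0 then r * \<epsilon> / M else 0)"
        using r1 \<epsilon>(1) M by (auto simp: S_def y_def intro!: sum.cong)
      then have Sy: "S y = r * \<epsilon> / M" using X(2) by simp
      then have \<rho>y: "\<rho> y = r" using \<epsilon>(1) M by (simp add: \<rho>_def)
      have "y \<in> topspace ?E" using zero[OF c] X(2) by (auto simp: topspace_Euclidean_space y_def)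
      then have "y \<in> V" using \<epsilon>(3) \<rho>_le[of y] \<rho>y r1 by auto
      moreover have "\<beta> g y 0 \<noteq> \<beta> h y 0"
        using r r1 \<rho>y X(2) \<epsilon>(1) M by (simp add: \<beta>_def y_def max_def)
      ultimately show ?thesis using VE by (auto intro!: bexI[of _ y])
    qed
  qed (rule \<beta>cont)
  moreover have "compactin ?Y ?K" using \<epsilon> by (auto simp: compactin_subtopology)
  ultimately show ?thesis
    using X(1) \<beta>inv \<nu>(1) off
    by (intro effective_action_extend_by_identity[OF _ U(1) ff', of T mul \<beta> ?K \<nu>])
      (auto simp: manifold_of_dim_def)
qed

subsection \<open>The universal cover of the special linear group\<close>

definition mat2 :: "real \<Rightarrow> real \<Rightarrow> real \<Rightarrow> real \<Rightarrow> real^2^2" where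
  "mat2 a b c d = (\<chi> i j. if i = 1 then if j = 1 then a else b else if j = 1 then c else d)"

lemma mat2_nth [simp]:
  "mat2 a b c d $ 1 $ 1 = a" "mat2 a b c d $ 1 $ 2 = b"
  "mat2 a b c d $ 2 $ 1 = c" "mat2 a b c d $ 2 $ 2 = d"
  by (simp_all add: mat2_def)

lemma mat2_eq_iff:
  fixes A B :: "real^2^2"
  shows "A = B \<longleftrightarrow> A$1$1 = B$1$1 \<and> A$1$2 = B$1$2 \<and> A$2$1 = B$2$1 \<and> A$2$2 = B$2$2"
  by (auto simp: vec_eq_iff forall_2)

lemma matrix_mult_nth_2 [simp]: "((A :: real^2^2) ** B) $ i $ j = A$i$1 * B$1$j + A$i$2 * B$2$j"
  by (simp add: matrix_matrix_mult_def sum_2)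

lemma mat_1_nth_2 [simp]:
  "(mat 1 :: real^2^2) $ 1 $ 1 = 1" "(mat 1 :: real^2^2) $ 1 $ 2 = 0"
  "(mat 1 :: real^2^2) $ 2 $ 1 = 0" "(mat 1 :: real^2^2) $ 2 $ 2 = 1"
  by (simp_all add: mat_def)

lemma continuous_on_mat2 [continuous_intros]:
  assumes "continuous_on S a" "continuous_on S b" "continuous_on S c" "continuous_on S d"
  shows "continuous_on S (\<lambda>x. mat2 (a x) (b x) (c x) (d x))"
proof -
  have "continuous_on S (\<lambda>x. if i = 1 then if j = 1 then a x else b x
      else if j = 1 then c x else d x)" for i j :: 2
    using assms by (cases "i = 1"; cases "j = 1") auto
  then show ?thesis
    unfolding mat2_def by (intro continuous_on_vec_lambda)
qed

section \<open>One-parameter subgroups and the Iwasawa decomposition\<close>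

definition rotation :: "real \<Rightarrow> real^2^2" where
  "rotation t = mat2 (cos t) (- sin t) (sin t) (cos t)"

definition dilation :: "real \<Rightarrow> real^2^2" where
  "dilation s = mat2 (exp s) 0 0 (exp (- s))"

definition shear :: "real \<Rightarrow> real^2^2" where
  "shear b = mat2 1 b 0 1"

lemma one_parameter_subgroups:
  "rotation (x + y) = rotation x ** rotation y"
  "dilation (x + y) = dilation x ** dilation y"
  "shear (x + y) = shear x ** shear y"
  using exp_add[of "- x" "- y"]
  by (auto simp: mat2_eq_iff rotation_def dilation_def shear_def cos_add sin_add exp_add)

lemma one_parameter_continuous:
  "continuous_on S rotation" "continuous_on S dilation" "continuous_on S shear"
  unfolding rotation_def[abs_def] dilation_def[abs_def] shear_def[abs_def]
  by (intro continuous_intros)+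

lemma det_one_parameter:
  "det (rotation x) = 1" "det (dilation x) = 1" "det (shear x) = 1"
  by (simp_all add: det_2 rotation_def dilation_def shear_def flip: exp_add power2_eq_square)

text \<open>Cancellation by an inverse. This is how a multiplicative map into matrices of
  determinant 1 is seen to send the unit to the unit.\<close>

lemma det_1_idempotent:
  fixes A :: "real^2^2"
  assumes "det A = 1" "A ** A = A"
  shows "A = mat 1"
proof -
  obtain B where B: "A ** B = mat 1"
    using assms(1) invertible_det_nz[of A] unfolding invertible_def by auto
  then show ?thesis
    by (metis assms(2) matrix_mul_assoc matrix_mul_rid)
qed

lemma SL2_0_det: "A \<in> SL2_0 \<Longrightarrow> det A = 1"
  using connected_component_subset[of SL2 "mat 1"] by (auto simp: SL2_0_def SL2_def)

lemma connected_subset_SL2_0: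
  assumes "connected S" "\<And>A. A \<in> S \<Longrightarrow> det A = 1" "mat 1 \<in> S"
  shows "S \<subseteq> SL2_0"
  unfolding SL2_0_def using assms by (intro connected_component_maximal) (auto simp: SL2_def)

text \<open>Columns are read as complex numbers, the images of 1 and \<open>\<i>\<close> under the
  linear map, so that complex logarithms and winding numbers apply to them.\<close>

definition col1 :: "real^2^2 \<Rightarrow> complex" where "col1 A = Complex (A$1$1) (A$2$1)"
definition col2 :: "real^2^2 \<Rightarrow> complex" where "col2 A = Complex (A$1$2) (A$2$2)"

lemma col_eq_iff: "A = B \<longleftrightarrow> col1 A = col1 B \<and> col2 A = col2 B"
  by (auto simp: col1_def col2_def mat2_eq_iff)

lemma continuous_on_col [continuous_intros]:
  assumes "continuous_on S f"
  shows "continuous_on S (\<lambda>x. col1 (f x))" "continuous_on S (\<lambda>x. col2 (f x))"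
  unfolding col1_def col2_def by (intro continuous_intros assms)+

lemma det_col: "det A = Im (cnj (col1 A) * col2 A)"
  by (simp add: det_2 col1_def col2_def)

lemma col1_nonzero: "det A = 1 \<Longrightarrow> col1 A \<noteq> 0"
  by (auto simp: det_col)

text \<open>The Iwasawa decomposition, with the compact and diagonal parameters as imaginary and real
  part of a logarithm of the first column.\<close>
definition iwasawa :: "complex \<times> real \<Rightarrow> real^2^2" where
  "iwasawa x = rotation (Im (fst x)) ** dilation (Re (fst x)) ** shear (snd x)"

text \<open>The quotient of the second column by the first is a point of the upper half-plane: its
  real part is the shear parameter and its imaginary part encodes the dilation.\<close>

lemma col_iwasawa:
  "col1 (iwasawa x) = exp (fst x)"
  "col2 (iwasawa x) = exp (fst x) * Complex (snd x) (exp (- 2 * Re (fst x)))"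
proof -
  show "col1 (iwasawa x) = exp (fst x)"
    by (simp add: complex_eq_iff col1_def iwasawa_def rotation_def dilation_def shear_def Re_exp Im_exp)
  have "exp (Re (fst x)) * exp (- 2 * Re (fst x)) = exp (- Re (fst x))"
    by (simp flip: exp_add)
  then show "col2 (iwasawa x) = exp (fst x) * Complex (snd x) (exp (- 2 * Re (fst x)))"
    by (simp add: complex_eq_iff col2_def iwasawa_def rotation_def dilation_def shear_def
        Re_exp Im_exp algebra_simps)
qed

text \<open>The auxiliary \<open>z\<close> moves the branch cut of \<open>Ln\<close> away from
  matrices whose first column is near \<open>exp z\<close>. The first column is matched by
  construction; determinant 1 forces the imaginary part of the column quotient to be the inverse
  square of the length of the first column.\<close>

lemma iwasawa_Ln:
  assumes "det A = 1"
  shows "iwasawa (Ln (col1 A / exp z) + z, Re (col2 A / col1 A)) = A"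
proof -
  have nz: "col1 A \<noteq> 0" using assms by (rule col1_nonzero)
  define w where "w = Ln (col1 A / exp z) + z"
  have w: "exp w = col1 A" using nz by (simp add: w_def exp_add)
  have "exp (- 2 * Re w) = 1 / (exp (Re w))\<^sup>2"
    using exp_double[of "Re w"] by (simp add: exp_minus divide_inverse)
  also have "\<dots> = 1 / (cmod (col1 A))\<^sup>2" by (simp flip: w)
  also have "\<dots> = Im (col2 A / col1 A)"
    using assms by (simp add: det_col Im_divide cmod_power2 algebra_simps)
  finally have "Complex (Re (col2 A / col1 A)) (exp (- 2 * Re w)) = col2 A / col1 A"
    by (simp add: complex_eq_iff)
  then show ?thesis
    using nz w by (simp add: col_eq_iff col_iwasawa flip: w_def)
qed

text \<open>The first column fixes the logarithm up to multiples of \<open>2 * pi * \<i>\<close>;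
  equal imaginary parts remove this ambiguity.\<close>

lemma iwasawa_eq_iff_Im:
  assumes "iwasawa x = iwasawa y" "Im (fst x) = Im (fst y)"
  shows "x = y"
proof -
  have "exp (fst x) = exp (fst y)" using assms(1) col_iwasawa(1) by metis
  then have "exp (Re (fst x)) = exp (Re (fst y))" by (metis norm_exp_eq_Re)
  then have fst: "fst x = fst y" using assms(2) by (simp add: complex_eq_iff)
  have "col2 (iwasawa x) = col2 (iwasawa y)" using assms(1) by simp
  then have "snd x = snd y" by (simp add: col_iwasawa fst)
  then show ?thesis using fst by (simp add: prod_eq_iff)
qed

section \<open>Lifts through the covering map\<close>

locale SL2_cover =
  fixes G :: "('g::topological_space) monoid" (structure) and p :: "'g \<Rightarrow> real^2^2"
  assumes universal_cover: "is_universal_cover_SL2 G p"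
begin

sublocale group G
  using universal_cover by (simp add: is_universal_cover_SL2_def)

lemma covering: "covering_space (carrier G) p SL2_0"
  using universal_cover by (simp add: is_universal_cover_SL2_def)

lemma p_mult: "\<lbrakk>a \<in> carrier G; b \<in> carrier G\<rbrakk> \<Longrightarrow> p (a \<otimes> b) = p a ** p b"
  using universal_cover by (simp add: is_universal_cover_SL2_def)

lemma p_continuous: "continuous_on (carrier G) p"
  using covering covering_space_imp_continuous by blast

lemma p_image: "p ` carrier G = SL2_0"
  using covering covering_space_imp_surjective by blast

lemma det_p: "a \<in> carrier G \<Longrightarrow> det (p a) = 1"
  using p_image SL2_0_det by blast

lemma connected_carrier: "connected (carrier G)"
  using universal_cover by (simp add: is_universal_cover_SL2_def path_connected_imp_connected)

lemma p_one: "p \<one> = mat 1"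
  using p_mult[of \<one> \<one>] det_p[of \<one>] by (intro det_1_idempotent) auto

lemma p_inv: "a \<in> carrier G \<Longrightarrow> p (inv a) ** p a = mat 1" "a \<in> carrier G \<Longrightarrow> p a ** p (inv a) = mat 1"
  using p_mult[of "inv a" a] p_mult[of a "inv a"] p_one by auto

lemma continuous_on_mult:
  assumes "continuous_on S f" "continuous_on S h" "\<And>x. x \<in> S \<Longrightarrow> f x \<in> carrier G"
    "\<And>x. x \<in> S \<Longrightarrow> h x \<in> carrier G"
  shows "continuous_on S (\<lambda>x. f x \<otimes> h x)"
proof -
  have "continuous_on (carrier G \<times> carrier G) (\<lambda>z. fst z \<otimes> snd z)"
    using universal_cover by (simp add: is_universal_cover_SL2_def case_prod_unfold)
  from continuous_on_compose2[OF this continuous_on_Pair[OF assms(1,2)]]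
  show ?thesis using assms(3,4) by auto
qed

lemma continuous_on_inv:
  assumes "continuous_on S f" "\<And>x. x \<in> S \<Longrightarrow> f x \<in> carrier G"
  shows "continuous_on S (\<lambda>x. inv (f x))"
proof -
  have "continuous_on (carrier G) (\<lambda>a. inv a)"
    using universal_cover by (simp add: is_universal_cover_SL2_def)
  from continuous_on_compose2[OF this assms(1)] show ?thesis using assms(2) by auto
qed

text \<open>The covering-space lifting theorems of the library require the total space to lie in a normed
  space, so the lift is glued from translates of one local inverse of \<^term>\<open>p\<close>.\<close>
lemma one_parameter_lift:
  fixes r :: "real \<Rightarrow> real^2^2"
  assumes r: "continuous_on UNIV r" "\<And>x y. r (x + y) = r x ** r y" "\<And>x. det (r x) = 1"
  shows "\<exists>l. continuous_on UNIV l \<and> (\<forall>t. l t \<in> carrier G \<and> p (l t) = r t) \<and> l 0 = \<one>"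
proof -
  have r0: "r 0 = mat 1" using r(2)[of 0 0] r(3)[of 0] by (intro det_1_idempotent) auto
  have "connected (range r)" using r(1) by (intro connected_continuous_image) auto
  then have rSL: "range r \<subseteq> SL2_0"
    by (rule connected_subset_SL2_0) (use r(3) in auto, metis r0 rangeI)
  obtain T u q where T: "\<one> \<in> T" "openin (top_of_set (carrier G)) T" "p \<one> \<in> u"
      "openin (top_of_set SL2_0) u" "homeomorphism T u p q"
    using covering_space_local_homeomorphism[OF covering] by (metis one_closed)
  have "openin (top_of_set UNIV) (UNIV \<inter> r -` u)"
    using rSL by (intro continuous_openin_preimage[OF r(1) _ T(4)]) auto
  moreover have "0 \<in> r -` u" using r0 T(3) p_one by simp
  ultimately obtain \<delta> where \<delta>: "\<delta> > 0" "cball 0 \<delta> \<subseteq> r -` u"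
    using open_contains_cball_eq[of "r -` u"] by auto
  have TG: "T \<subseteq> carrier G" using T(2) openin_imp_subset by blast
  have q: "q (r t) \<in> carrier G" "p (q (r t)) = r t" if "\<bar>t\<bar> \<le> \<delta>" for t
  proof -
    have "r t \<in> u" using \<delta>(2) that by (force simp: dist_real_def)
    then show "q (r t) \<in> carrier G" "p (q (r t)) = r t"
      using T(5) TG by (auto simp: homeomorphism_def)
  qed
  have q1: "q (r 0) = \<one>" using T(1,5) r0 p_one by (metis homeomorphism_apply1)
  define c where "c = q (r \<delta>)"
  have c: "c \<in> carrier G" "p c = r \<delta>" using q[of \<delta>] \<delta>(1) by (auto simp: c_def)
  \<comment> \<open>Integer powers of \<open>c\<close> lie over the grid points
    \<open>k * \<delta>\<close>; they carry the local inverse to every grid interval.\<close>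
  have p_pow: "p (c [^] k) = r (of_int k * \<delta>)" for k :: int
  proof (induction k rule: int_induct[where k=0])
    case base
    then show ?case by (simp add: r0 p_one)
  next
    case (step1 i)
    have "p (c [^] (i + 1)) = r (of_int i * \<delta>) ** r \<delta>"
      using step1 c by (simp add: int_pow_mult p_mult)
    then show ?case by (simp add: algebra_simps flip: r(2))
  next
    case (step2 i)
    have "c [^] i = c [^] (i - 1) \<otimes> c" using int_pow_mult[OF c(1), of "i - 1" 1] c by simp
    then have "p (c [^] (i - 1)) ** r \<delta> = r (of_int i * \<delta>)"
      using step2 c by (simp add: p_mult)
    then have "p (c [^] (i - 1)) ** (r \<delta> ** r (- \<delta>)) = r (of_int i * \<delta>) ** r (- \<delta>)"
      by (simp add: matrix_mul_assoc)
    then show ?case by (simp add: r0 algebra_simps flip: r(2))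
  qed
  define piece where "piece k t = c [^] k \<otimes> q (r (t - of_int k * \<delta>))" for k :: int and t
  define l where "l t = piece \<lfloor>t / \<delta>\<rfloor> t" for t
  have near: "\<bar>t - of_int k * \<delta>\<bar> \<le> \<delta>" if "t \<in> {of_int k * \<delta>..of_int (k + 1) * \<delta>}" for k :: int and t
    using that by (auto simp: algebra_simps)
  \<comment> \<open>At the right end point the floor already jumps to \<open>k + 1\<close>; there
    \<open>q (r 0)\<close> is the unit, and both pieces give \<open>c [^] (k + 1)\<close>.\<close>
  have l_piece: "l t = piece k t" if t: "t \<in> {of_int k * \<delta>..of_int (k + 1) * \<delta>}" for k t
  proof (cases "t = of_int (k + 1) * \<delta>")
    case True
    then have "\<lfloor>t / \<delta>\<rfloor> = k + 1" using \<delta>(1) by simp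
    then have "l t = c [^] (k + 1)" using True c q1 by (simp add: l_def piece_def)
    moreover have "piece k t = c [^] k \<otimes> c" using True by (simp add: piece_def c_def algebra_simps)
    ultimately show ?thesis using c by (simp add: int_pow_mult)
  next
    case False
    then have "\<lfloor>t / \<delta>\<rfloor> = k" using \<delta>(1) t by (simp add: floor_eq_iff field_simps)
    then show ?thesis by (simp add: l_def)
  qed
  have covered: "t \<in> {of_int \<lfloor>t / \<delta>\<rfloor> * \<delta>..of_int (\<lfloor>t / \<delta>\<rfloor> + 1) * \<delta>}" for t
    using \<delta>(1) floor_divide_lower[of \<delta> t] floor_divide_upper[of \<delta> t] by auto
  have l: "l t \<in> carrier G" "p (l t) = r t" for t
    using q[OF near[OF covered[of t]]] c
    by (auto simp: l_def piece_def p_mult p_pow simp flip: r(2))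
  have cont_piece: "continuous_on {of_int k * \<delta>..of_int (k + 1) * \<delta>} l" for k :: int
  proof -
    have "continuous_on u q" using T(5) by (simp add: homeomorphism_def)
    moreover have "continuous_on {of_int k * \<delta>..of_int (k + 1) * \<delta>} (\<lambda>t. r (t - of_int k * \<delta>))"
      by (intro continuous_on_compose2[OF r(1)] continuous_intros) auto
    moreover have "(\<lambda>t. r (t - of_int k * \<delta>)) ` {of_int k * \<delta>..of_int (k + 1) * \<delta>} \<subseteq> u"
      using \<delta>(2) near[of _ k] by (force simp: dist_real_def subset_iff)
    ultimately have "continuous_on {of_int k * \<delta>..of_int (k + 1) * \<delta>} (\<lambda>t. q (r (t - of_int k * \<delta>)))"
      by (rule continuous_on_compose2)
    then have "continuous_on {of_int k * \<delta>..of_int (k + 1) * \<delta>} (piece k)"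
      unfolding piece_def using c q(1)[OF near[of _ k]] by (intro continuous_on_mult) auto
    moreover have "continuous_on {of_int k * \<delta>..of_int (k + 1) * \<delta>} l \<longleftrightarrow>
        continuous_on {of_int k * \<delta>..of_int (k + 1) * \<delta>} (piece k)"
      by (rule continuous_on_cong[OF refl l_piece])
    ultimately show ?thesis by blast
  qed
  have "isCont l t" for t
  proof -
    define k where "k = \<lfloor>t / \<delta>\<rfloor>"
    \<comment> \<open>The preceding interval is added because \<open>t\<close> may be the left end
      point of its own.\<close>
    let ?S = "{of_int (k - 1) * \<delta>..of_int k * \<delta>} \<union> {of_int k * \<delta>..of_int (k + 1) * \<delta>}"
    have "continuous_on ?S l"
      using cont_piece[of k] cont_piece[of "k - 1"] by (intro continuous_on_closed_Un) auto
    then have "continuous_on {of_int (k - 1) * \<delta><..<of_int (k + 1) * \<delta>} l"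
      by (rule continuous_on_subset) auto
    moreover have "t \<in> {of_int (k - 1) * \<delta><..<of_int (k + 1) * \<delta>}"
      using \<delta>(1) floor_divide_lower[of \<delta> t] floor_divide_upper[of \<delta> t]
      by (auto simp: k_def algebra_simps)
    ultimately show ?thesis by (simp add: continuous_on_eq_continuous_at)
  qed
  then have "continuous_on UNIV l" by (simp add: continuous_on_eq_continuous_at)
  moreover have "l 0 = \<one>" by (simp add: l_def piece_def q1)
  ultimately show ?thesis using l by blast
qed

lemma p_injective_near:
  assumes "a \<in> carrier G"
  obtains T where "a \<in> T" "openin (top_of_set (carrier G)) T" "inj_on p T"
proof -
  obtain T u q where "a \<in> T" "openin (top_of_set (carrier G)) T" "homeomorphism T u p q"
    using covering_space_local_homeomorphism[OF covering assms] by metis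
  then show ?thesis using that by (metis homeomorphism_apply1 inj_on_inverseI)
qed

text \<open>The covering map is locally injective, so a continuous map into its kernel is locally
  constant.\<close>

lemma kernel_valued_constant:
  fixes f :: "'b::topological_space \<Rightarrow> 'g"
  assumes S: "connected S" and f: "continuous_on S f" "\<And>x. x \<in> S \<Longrightarrow> f x \<in> carrier G"
    and p: "\<And>x. x \<in> S \<Longrightarrow> p (f x) = mat 1" and "x \<in> S" "y \<in> S"
  shows "f x = f y"
proof (rule connected_equivalence_relation[OF S \<open>x \<in> S\<close> \<open>y \<in> S\<close>, where R = "\<lambda>x y. f x = f y"])
  show "\<exists>T. openin (top_of_set S) T \<and> a \<in> T \<and> (\<forall>x\<in>T. f a = f x)"
    if a: "a \<in> S" for a
  proof -
    obtain T where T: "f a \<in> T" "openin (top_of_set (carrier G)) T" "inj_on p T"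
      using p_injective_near f(2) a by metis
    have "openin (top_of_set S) (S \<inter> f -` T)"
      using f by (intro continuous_openin_preimage[OF f(1) _ T(2)]) auto
    moreover have "f a = f x" if "x \<in> S \<inter> f -` T" for x
      using that p a T(1) inj_onD[OF T(3), of "f a" "f x"] by simp
    moreover have "a \<in> S \<inter> f -` T" using a T(1) by simp
    ultimately show ?thesis by blast
  qed
qed (auto)

section \<open>Global coordinates on the covering group\<close>

definition is_section :: "(complex \<times> real \<Rightarrow> 'g) \<Rightarrow> bool" where
  "is_section \<sigma> \<longleftrightarrow> continuous_on UNIV \<sigma> \<and> (\<forall>x. \<sigma> x \<in> carrier G \<and> p (\<sigma> x) = iwasawa x)"

lemma is_sectionD:
  assumes "is_section \<sigma>"
  shows "continuous_on UNIV \<sigma>" "\<sigma> x \<in> carrier G" "p (\<sigma> x) = iwasawa x"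
  using assms unfolding is_section_def by blast+

lemma section_exists: "\<exists>\<sigma>. is_section \<sigma> \<and> \<sigma> 0 = \<one>"
proof -
  obtain l1 where l1: "continuous_on UNIV l1" "\<And>t. l1 t \<in> carrier G" "\<And>t. p (l1 t) = rotation t"
      "l1 0 = \<one>"
    using one_parameter_lift[of rotation] one_parameter_subgroups one_parameter_continuous
      det_one_parameter by metis
  obtain l2 where l2: "continuous_on UNIV l2" "\<And>t. l2 t \<in> carrier G" "\<And>t. p (l2 t) = dilation t"
      "l2 0 = \<one>"
    using one_parameter_lift[of dilation] one_parameter_subgroups one_parameter_continuous
      det_one_parameter by metis
  obtain l3 where l3: "continuous_on UNIV l3" "\<And>t. l3 t \<in> carrier G" "\<And>t. p (l3 t) = shear t"
      "l3 0 = \<one>"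
    using one_parameter_lift[of shear] one_parameter_subgroups one_parameter_continuous
      det_one_parameter by metis
  define \<sigma> where "\<sigma> x = l1 (Im (fst x)) \<otimes> l2 (Re (fst x)) \<otimes> l3 (snd x)" for x
  have "continuous_on UNIV \<sigma>"
    unfolding \<sigma>_def using l1(2) l2(2) l3(2)
    by (intro continuous_on_mult continuous_on_compose2[OF l1(1)] continuous_on_compose2[OF l2(1)]
        continuous_on_compose2[OF l3(1)] continuous_intros) auto
  then have "is_section \<sigma>"
    using l1 l2 l3 by (simp add: is_section_def \<sigma>_def p_mult iwasawa_def)
  moreover have "\<sigma> 0 = \<one>" using l1 l2 l3 by (simp add: \<sigma>_def)
  ultimately show ?thesis by blast
qed

lemma section_translate:
  assumes "is_section \<sigma>" "k \<in> carrier G" "p k = mat 1"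
  shows "is_section (\<lambda>x. \<sigma> x \<otimes> k)"
  unfolding is_section_def
  using assms(2,3) is_sectionD[OF assms(1)]
  by (auto simp: p_mult intro!: continuous_on_mult)

text \<open>The candidate \<open>h\<close> reads Iwasawa coordinates off \<open>p g\<close> with the
  logarithm centred at \<open>x\<close>, so \<open>\<sigma> (h g)\<close> and \<open>g\<close> have
  the same image under \<open>p\<close>. They agree where both lie in a set on which
  \<open>p\<close> is injective. This gives openness of the image and, later, continuity of the
  inverse, without invariance of domain.\<close>

lemma section_local_inverse:
  assumes \<sigma>: "is_section \<sigma>"
  obtains N h where "openin (top_of_set (carrier G)) N" "\<sigma> x \<in> N"
    "continuous_on N h" "\<And>g. g \<in> N \<Longrightarrow> \<sigma> (h g) = g"
proof -
  note \<sigma>p = is_sectionD(2,3)[OF \<sigma>]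
  obtain T where T: "\<sigma> x \<in> T" "openin (top_of_set (carrier G)) T" "inj_on p T"
    using p_injective_near \<sigma>p(1) by metis
  let ?z = "fst x"
  define h where "h g = (Ln (col1 (p g) / exp ?z) + ?z, Re (col2 (p g) / col1 (p g)))" for g
  \<comment> \<open>The quotient is 1 at \<open>\<sigma> x\<close>, so removing the branch cut
    leaves a neighbourhood of that point.\<close>
  define D where "D = carrier G \<inter> (\<lambda>g. col1 (p g) / exp ?z) -` (- \<real>\<^sub>\<le>\<^sub>0)"
  have "continuous_on (carrier G) (\<lambda>g. col1 (p g) / exp ?z)"
    by (intro continuous_intros p_continuous) auto
  then have D: "openin (top_of_set (carrier G)) D"
    unfolding D_def by (intro continuous_openin_preimage_gen) auto
  have DG: "D \<subseteq> carrier G" by (auto simp: D_def)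
  have nz: "col1 (p g) \<noteq> 0" if "g \<in> carrier G" for g
    using det_p[OF that] by (rule col1_nonzero)
  have hcont: "continuous_on D h"
    unfolding h_def using nz DG
    by (intro continuous_intros continuous_on_subset[OF p_continuous DG]) (auto simp: D_def)
  have ph: "p (\<sigma> (h g)) = p g" if "g \<in> carrier G" for g
    unfolding \<sigma>p h_def by (rule iwasawa_Ln[OF det_p[OF that]])
  have hx: "h (\<sigma> x) = x"
    by (simp add: h_def \<sigma>p col_iwasawa prod_eq_iff)
  have "continuous_on D (\<lambda>g. \<sigma> (h g))"
    using continuous_on_compose2[OF is_sectionD(1)[OF \<sigma>] hcont] by simp
  then have "openin (top_of_set D) (D \<inter> (\<lambda>g. \<sigma> (h g)) -` T)"
    using \<sigma>p(1) by (intro continuous_openin_preimage[OF _ _ T(2)]) auto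
  then have "openin (top_of_set (carrier G)) (D \<inter> (\<lambda>g. \<sigma> (h g)) -` T)"
    using D openin_trans by blast
  then have "openin (top_of_set (carrier G)) (T \<inter> (D \<inter> (\<lambda>g. \<sigma> (h g)) -` T))"
    using T(2) by blast
  moreover have "\<sigma> x \<in> T \<inter> (D \<inter> (\<lambda>g. \<sigma> (h g)) -` T)"
    using T(1) hx by (simp add: D_def \<sigma>p col_iwasawa)
  moreover have "continuous_on (T \<inter> (D \<inter> (\<lambda>g. \<sigma> (h g)) -` T)) h"
    by (rule continuous_on_subset[OF hcont]) auto
  moreover have "\<sigma> (h g) = g" if "g \<in> T \<inter> (D \<inter> (\<lambda>g. \<sigma> (h g)) -` T)" for g
    using that ph[of g] DG T(3) by (auto dest: inj_onD)
  ultimately show ?thesis by (rule that)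
qed

text \<open>The carrier is covered by the open images of the translates of \<open>\<sigma>\<close> by elements of the kernel of
  \<^term>\<open>p\<close>. Moving once around the circle multiplies \<open>\<sigma>\<close> on the right by a constant, so two such images
  that meet coincide, and connectedness leaves only one.\<close>
lemma section_surjective:
  assumes \<sigma>: "is_section \<sigma>" and one: "\<sigma> 0 = \<one>" and g: "g \<in> carrier G"
  shows "g \<in> range \<sigma>"
proof -
  note \<sigma>p = is_sectionD(2,3)[OF \<sigma>]
  have indep: "\<sigma> y \<otimes> k \<in> range \<sigma>"
    if k: "k \<in> carrier G" "p k = mat 1" and x: "\<sigma> x \<otimes> k \<in> range \<sigma>" for k x y
  proof -
    obtain x' where x': "\<sigma> x \<otimes> k = \<sigma> x'" using x by auto
    then have "iwasawa x' = iwasawa x" using \<sigma>p k p_mult[of "\<sigma> x" k] by simp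
    then have "exp (fst x') = exp (fst x)" by (metis col_iwasawa(1))
    then obtain n :: int where n: "fst x' = fst x + of_int (2 * n) * of_real pi * \<i>"
      using exp_eq[of "fst x'" "fst x"] by auto
    define d :: "complex \<times> real" where "d = (of_int (2 * n) * of_real pi * \<i>, 0)"
    have per: "iwasawa (y + d) = iwasawa y" for y
    proof -
      have "exp (fst (y + d)) = exp (fst y)" unfolding exp_eq by (auto simp: d_def)
      then show ?thesis by (simp add: col_eq_iff col_iwasawa d_def)
    qed
    have "col2 (iwasawa x') = col2 (iwasawa (x + d))" using \<open>iwasawa x' = iwasawa x\<close> per by simp
    moreover have fst': "fst x' = fst (x + d)" using n by (simp add: d_def)
    ultimately have "x' = x + d" 
      using iwasawa_eq_iff_Im[of x' "x + d"] \<open>iwasawa x' = iwasawa x\<close> per by simp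
    \<comment> \<open>Translation by \<open>d\<close> is right multiplication by an element of the
      kernel; connectedness makes this element independent of \<open>y\<close>, and at
      \<open>x\<close> it is \<open>k\<close>.\<close>
    define f where "f y = inv (\<sigma> y) \<otimes> \<sigma> (y + d)" for y
    note cont = is_sectionD(1)[OF \<sigma>]
    have "continuous_on UNIV (\<lambda>y. \<sigma> (y + d))"
      by (rule continuous_on_compose2[OF cont]) (auto intro: continuous_intros)
    then have "continuous_on UNIV f"
      unfolding f_def using cont \<sigma>p by (intro continuous_on_mult continuous_on_inv) auto
    moreover have "p (f y) = mat 1" for y
      using p_inv[OF \<sigma>p(1)[of y]] by (simp add: f_def p_mult \<sigma>p per)
    moreover have "f y \<in> carrier G" for y by (simp add: f_def \<sigma>p)
    ultimately have "f y = f x" by (intro kernel_valued_constant[of UNIV f]) auto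
    also have "f x = k"
      unfolding f_def using x' \<open>x' = x + d\<close> \<sigma>p k by (metis inv_solve_left)
    finally have "\<sigma> y \<otimes> k = \<sigma> y \<otimes> (inv (\<sigma> y) \<otimes> \<sigma> (y + d))" by (simp add: f_def)
    also have "\<dots> = \<sigma> (y + d)" using \<sigma>p by (simp flip: m_assoc)
    finally show ?thesis by auto
  qed
  have "\<one> \<in> range \<sigma> \<longleftrightarrow> g \<in> range \<sigma>"
  proof (rule connected_equivalence_relation[OF connected_carrier one_closed g,
        where R = "\<lambda>x y. x \<in> range \<sigma> \<longleftrightarrow> y \<in> range \<sigma>"])
    show "\<exists>T. openin (top_of_set (carrier G)) T \<and> a \<in> T \<and>
        (\<forall>x\<in>T. a \<in> range \<sigma> \<longleftrightarrow> x \<in> range \<sigma>)" if a: "a \<in> carrier G" for a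
    proof -
      \<comment> \<open>Any coordinates of \<open>p a\<close> serve here, so the logarithm is taken
        with \<open>z = 0\<close>.\<close>
      define x where "x = (Ln (col1 (p a) / exp 0) + 0, Re (col2 (p a) / col1 (p a)))"
      have x: "iwasawa x = p a" unfolding x_def by (rule iwasawa_Ln[OF det_p[OF a]])
      define k where "k = inv (\<sigma> x) \<otimes> a"
      have k: "k \<in> carrier G" "p k = mat 1"
        using a \<sigma>p p_inv[OF \<sigma>p(1)[of x]] by (auto simp: k_def p_mult x)
      have ax: "a = \<sigma> x \<otimes> k" using a \<sigma>p by (simp add: k_def flip: m_assoc)
      obtain N h where N: "openin (top_of_set (carrier G)) N" "\<sigma> x \<otimes> k \<in> N"
          "\<And>g. g \<in> N \<Longrightarrow> \<sigma> (h g) \<otimes> k = g"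
        using section_local_inverse[OF section_translate[OF \<sigma> k], of x] by metis
      show ?thesis
      proof (intro exI conjI ballI)
        show "openin (top_of_set (carrier G)) N" by (rule N(1))
        show "a \<in> N" using N(2) ax by simp
        show "a \<in> range \<sigma> \<longleftrightarrow> b \<in> range \<sigma>" if "b \<in> N" for b
          using indep[OF k] N(3)[OF that] ax by metis
      qed
    qed
  qed auto
  then show ?thesis using one by (metis rangeI)
qed

text \<open>If \<open>\<sigma>\<close> identifies two points, the image of the segment between them is a null-homotopic loop, so
  the loop of first columns in the punctured plane has winding number 0.\<close>
lemma section_injective:
  assumes \<sigma>: "is_section \<sigma>" and eq: "\<sigma> x = \<sigma> y"
  shows "x = y"
proof -
  note \<sigma>p = is_sectionD(2,3)[OF \<sigma>]
  let ?l = "\<sigma> \<circ> linepath x y"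
  have path: "path ?l"
    using continuous_on_subset[OF is_sectionD(1)[OF \<sigma>]] by (intro path_continuous_image) auto
  have "homotopic_loops (carrier G) ?l ((\<lambda>_. \<sigma> x))"
  proof -
    have "simply_connected (carrier G)"
      using universal_cover by (simp add: is_universal_cover_SL2_def)
    moreover have "pathfinish ?l = pathstart ?l"
      using eq by (simp add: pathfinish_compose pathstart_compose)
    moreover have "path_image ?l \<subseteq> carrier G"
      unfolding path_image_def using \<sigma>p(1) by (metis comp_apply image_subsetI)
    moreover have "path (\<lambda>_. \<sigma> x)" "pathfinish (\<lambda>_. \<sigma> x) = pathstart (\<lambda>_. \<sigma> x)"
        "path_image (\<lambda>_. \<sigma> x) \<subseteq> carrier G"
      using \<sigma>p(1)[of x] by (auto simp: path_def pathfinish_def pathstart_def path_image_def)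
    ultimately show ?thesis using path unfolding simply_connected_def by blast
  qed
  then have "homotopic_loops (- {0}) ((col1 \<circ> p) \<circ> ?l) ((col1 \<circ> p) \<circ> (\<lambda>_. \<sigma> x))"
  proof (rule homotopic_loops_continuous_image)
    show "continuous_on (carrier G) (col1 \<circ> p)"
      unfolding o_def by (intro continuous_intros p_continuous)
    show "col1 \<circ> p \<in> carrier G \<rightarrow> - {0}"
      using det_p col1_nonzero by auto
  qed
  then have "winding_number ((col1 \<circ> p) \<circ> ?l) 0 = winding_number ((col1 \<circ> p) \<circ> (\<lambda>_. \<sigma> x)) 0"
    by (rule winding_number_homotopic_loops)
  also have "(col1 \<circ> p) \<circ> (\<lambda>_. \<sigma> x) = linepath (exp (fst x)) (exp (fst x))"
    by (auto simp: \<sigma>p col_iwasawa linepath_def)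
  also have "(col1 \<circ> p) \<circ> ?l = exp \<circ> linepath (fst x) (fst y)"
    by (auto simp: \<sigma>p col_iwasawa linepath_def)
  finally have "winding_number (exp \<circ> linepath (fst x) (fst y)) 0 = 0"
    unfolding winding_number_trivial[OF exp_not_eq_zero[symmetric]] .
  \<comment> \<open>The winding number of \<open>exp\<close> along a segment is the difference of
    its end points over \<open>2 * pi * \<i>\<close>. Its vanishing settles the first coordinate,
    and equality of the matrices then settles the second.\<close>
  then have "(fst y - fst x) / (2 * of_real pi * \<i>) = 0"
    using winding_number_compose_exp[OF path_linepath, of "fst x" "fst y"] by (simp del: linepath_refl)
  then have "fst x = fst y" by simp
  then show ?thesis using eq iwasawa_eq_iff_Im[of x y] \<sigma>p(2) by metis
qed

text \<open>The chart is the inverse of a section; by injectivity it agrees near each point with a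
  continuous local inverse.\<close>

lemma iwasawa_coordinates:
  obtains \<Psi> where "continuous_on (carrier G) \<Psi>" "\<And>g. g \<in> carrier G \<Longrightarrow> iwasawa (\<Psi> g) = p g"
    "inj_on \<Psi> (carrier G)" "\<Psi> \<one> = 0"
proof -
  obtain \<sigma> where \<sigma>: "is_section \<sigma>" "\<sigma> 0 = \<one>" using section_exists by blast
  have inj: "inj \<sigma>" using section_injective[OF \<sigma>(1)] by (rule injI)
  define \<Psi> where "\<Psi> = inv_into UNIV \<sigma>"
  have \<Psi>: "\<sigma> (\<Psi> g) = g" if "g \<in> carrier G" for g
    using section_surjective[OF \<sigma> that] by (simp add: \<Psi>_def f_inv_into_f)
  have "continuous_on (carrier G) \<Psi>"
    unfolding continuous_on_def
  proof
    fix g assume g: "g \<in> carrier G"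
    obtain N h where N: "openin (top_of_set (carrier G)) N" "g \<in> N"
        "continuous_on N h" "\<And>g. g \<in> N \<Longrightarrow> \<sigma> (h g) = g"
      using section_local_inverse[OF \<sigma>(1), of "\<Psi> g"] \<Psi>[OF g] by metis
    obtain O' where O': "open O'" "N = carrier G \<inter> O'" using N(1) by (auto simp: openin_open)
    have "h a = \<Psi> a" if "a \<in> N" for a
      using N(4)[OF that] inj by (metis \<Psi>_def inv_f_f)
    then have "continuous_on N \<Psi>" using N(3) by (simp cong: continuous_on_cong)
    then have "(\<Psi> \<longlongrightarrow> \<Psi> g) (at g within N)" using N(2) by (simp add: continuous_on_def)
    moreover have "at g within N = at g within carrier G"
      by (rule at_within_nhd[of g O']) (use O' N(2) in auto)
    ultimately show "(\<Psi> \<longlongrightarrow> \<Psi> g) (at g within carrier G)" by simp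
  qed
  moreover have "iwasawa (\<Psi> g) = p g" if "g \<in> carrier G" for g
    using \<Psi>[OF that] \<sigma>(1) by (metis is_section_def)
  moreover have "inj_on \<Psi> (carrier G)" using \<Psi> by (metis inj_onI)
  moreover have "\<Psi> \<one> = 0" using \<sigma>(2) inj by (metis \<Psi>_def inv_f_f)
  ultimately show ?thesis by (rule that)
qed

end

text \<open>Two lifts of one map to the circle differ by an integer multiple of
  \<open>2 * pi\<close> that varies continuously, hence is constant on a connected set. Identities
  on the line can thus be checked on the circle and at one point.\<close>

lemma equal_of_cis_equal:
  fixes f h :: "'a::topological_space \<Rightarrow> real"
  assumes S: "connected S" and cont: "continuous_on S f" "continuous_on S h"
    and cis: "\<And>x. x \<in> S \<Longrightarrow> cis (f x) = cis (h x)"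
    and a: "a \<in> S" "f a = h a" and x: "x \<in> S"
  shows "f x = h x"
proof -
  define d where "d x = (f x - h x) / (2 * pi)" for x
  have "d x \<in> \<int>" if "x \<in> S" for x
  proof -
    have "cis (f x - h x) = 1" using cis[OF that] by (simp flip: cis_divide)
    then have "cos (f x - h x) = 1" by (simp add: complex_eq_iff)
    then obtain n :: int where "f x - h x = of_int n * 2 * pi" using cos_one_2pi_int by auto
    then show ?thesis by (simp add: d_def)
  qed
  then have int: "d x - d y \<in> \<int>" if "x \<in> S" "y \<in> S" for x y using that by simp
  have "d constant_on S"
  proof (rule continuous_discrete_range_constant[OF S])
    show "continuous_on S d" unfolding d_def by (intro continuous_intros cont) simp
    show "\<exists>e>0. \<forall>y. y \<in> S \<and> d y \<noteq> d x \<longrightarrow> e \<le> norm (d y - d x)" if "x \<in> S" for x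
      using int[OF _ that] by (intro exI[of _ 1]) (auto simp: Ints_nonzero_abs_ge1)
  qed
  then have "d x = d a" using x a(1) by (auto simp: constant_on_def)
  then show ?thesis using a(2) by (simp add: d_def)
qed

section \<open>The action on directions and its lift\<close>

definition act :: "real^2^2 \<Rightarrow> complex \<Rightarrow> complex" where
  "act A z = col1 A * of_real (Re z) + col2 A * of_real (Im z)"

lemma act_mult: "act (A ** B) z = act A (act B z)"
  by (simp add: act_def col1_def col2_def complex_eq_iff algebra_simps)

lemma act_one: "act (mat 1) z = z"
  by (simp add: act_def col1_def col2_def complex_eq_iff)

lemma act_of_real_mult: "act A (of_real c * z) = of_real c * act A z"
  by (simp add: act_def algebra_simps)

text \<open>Linear maps respect positive multiples, so normalising at every step or only at the end
  gives the same direction.\<close>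

lemma sgn_act_sgn: "sgn (act A (sgn z)) = sgn (act A z)"
proof (cases "z = 0")
  case False
  have "act A (sgn z) = of_real (inverse (cmod z)) * act A z"
    unfolding sgn_div_norm scaleR_conv_of_real by (rule act_of_real_mult)
  then show ?thesis using False by (simp add: Real_Vector_Spaces.sgn_mult sgn_of_real)
qed simp

lemma sgn_exp: "sgn (exp z) = cis (Im z)"
  by (simp add: exp_eq_polar Real_Vector_Spaces.sgn_mult sgn_of_real sgn_cis)

text \<open>Once \<open>exp\<close> is removed, the coefficient of \<open>sin t\<close> has positive
  imaginary part, so vanishing would give \<open>sin t = 0\<close> and then
  \<open>cos t = 0\<close>.\<close>

lemma act_iwasawa_nonzero: "act (iwasawa x) (cis t) \<noteq> 0"
proof
  assume "act (iwasawa x) (cis t) = 0"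
  then have "exp (fst x) * (cos t + Complex (snd x) (exp (- 2 * Re (fst x))) * sin t) = 0"
    by (simp add: act_def col_iwasawa algebra_simps)
  then have "cos t + Complex (snd x) (exp (- 2 * Re (fst x))) * sin t = 0" by simp
  then have "sin t = 0" "cos t + snd x * sin t = 0" unfolding complex_eq_iff by auto
  then show False using sin_cos_squared_add[of t] by simp
qed

context SL2_cover
begin

text \<open>Over the contractible coordinate space the moved unit vector has a continuous logarithm,
  whose imaginary part is the lifted angle. The chart lets \<open>F\<close> separate elements with
  the same image under \<open>p\<close>.\<close>

lemma lifted_circle_action:
  obtains F where "continuous_on (carrier G \<times> UNIV) (\<lambda>(g,t). F g t)"
    "\<And>g t. g \<in> carrier G \<Longrightarrow> cis (F g t) = sgn (act (p g) (cis t))"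
    "F \<one> 0 = 0"
    "\<And>g. \<lbrakk>g \<in> carrier G; \<And>t. F g t = t\<rbrakk> \<Longrightarrow> g = \<one>"
proof -
  obtain \<Psi> where \<Psi>: "continuous_on (carrier G) \<Psi>" "\<And>g. g \<in> carrier G \<Longrightarrow> iwasawa (\<Psi> g) = p g"
    "inj_on \<Psi> (carrier G)" "\<Psi> \<one> = 0" using iwasawa_coordinates by blast
  have cont: "continuous_on UNIV (\<lambda>(x,t). act (iwasawa x) (cis t))"
    unfolding act_def case_prod_unfold col_iwasawa by (intro continuous_intros)
  have "contractible (UNIV :: ((complex \<times> real) \<times> real) set)"
    by (simp add: convex_imp_contractible)
  from continuous_logarithm_on_contractible[OF cont this]
  obtain L where L: "continuous_on UNIV L"
      "\<And>y. (case y of (x,t) \<Rightarrow> act (iwasawa x) (cis t)) = exp (L y)"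
    using act_iwasawa_nonzero by (metis (no_types, lifting) UNIV_I case_prod_unfold)
  then have L: "continuous_on UNIV L" "\<And>x t. act (iwasawa x) (cis t) = exp (L (x,t))"
    by (simp_all add: split_paired_all)
  \<comment> \<open>\<open>L (x, 0)\<close> and \<open>fst x\<close> are logarithms of the same
    number, so the correction is a multiple of \<open>2 * pi\<close>; it makes the rotation
    parameter the image of 0.\<close>
  define F where "F g t = Im (L (\<Psi> g, t)) - Im (L (\<Psi> g, 0)) + Im (fst (\<Psi> g))" for g t
  have F0: "F g 0 = Im (fst (\<Psi> g))" for g by (simp add: F_def)
  have "continuous_on (carrier G \<times> UNIV) (\<lambda>z. F (fst z) (snd z))"
    unfolding F_def
    by (intro continuous_intros continuous_on_compose2[OF L(1)] continuous_on_compose2[OF \<Psi>(1)]) auto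
  then have "continuous_on (carrier G \<times> UNIV) (\<lambda>(g,t). F g t)" by (simp add: case_prod_unfold)
  moreover have cisF: "cis (F g t) = sgn (act (p g) (cis t))" if "g \<in> carrier G" for g t
  proof -
    have "exp (L (\<Psi> g, 0)) = exp (fst (\<Psi> g))"
      using L(2)[of "\<Psi> g" 0] by (simp add: act_def col_iwasawa)
    then have "cis (Im (L (\<Psi> g, 0))) = cis (Im (fst (\<Psi> g)))" by (metis sgn_exp)
    then have "cis (F g t) = cis (Im (L (\<Psi> g, t)))"
      by (simp add: F_def flip: cis_mult cis_divide)
    also have "\<dots> = sgn (act (p g) (cis t))"
      using L(2)[of "\<Psi> g" t] \<Psi>(2)[OF that] by (simp add: sgn_exp)
    finally show ?thesis .
  qed
  moreover have "F \<one> 0 = 0" by (simp add: F0 \<Psi>)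
  moreover have "g = \<one>" if g: "g \<in> carrier G" and triv: "\<And>t. F g t = t" for g
  proof -
    define z where "z = fst (\<Psi> g)"
    \<comment> \<open>As \<open>F g 0\<close> is the rotation parameter, this excludes the
      nontrivial elements of the kernel of \<open>p\<close>.\<close>
    have im: "Im z = 0" using F0[of g] triv[of 0] by (simp add: z_def)
    then have exp_z: "exp z = of_real (exp (Re z))" by (simp add: exp_eq_polar)
    have dir: "sgn (act (p g) (cis t)) = cis t" for t using cisF[OF g, of t] triv by simp
    have ray: "Re (act (p g) (cis t)) * sin t = Im (act (p g) (cis t)) * cos t" for t
    proof -
      have "act (p g) (cis t) = of_real (cmod (act (p g) (cis t))) * cis t"
        using dir[of t] by (metis complex_sgn_def mult.commute scaleR_conv_of_real
            sgn_zero_iff norm_sgn sgn_div_norm mult_zero_left of_real_0 norm_zero divideR_right norm_eq_zero)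
      then obtain c where "act (p g) (cis t) = of_real c * cis t" by blast
      then show ?thesis by simp
    qed
    have colp: "col1 (p g) = exp z" "col2 (p g) = exp z * Complex (snd (\<Psi> g)) (exp (- 2 * Re z))"
      using \<Psi>(2)[OF g] col_iwasawa[of "\<Psi> g"] by (simp_all add: z_def)
    \<comment> \<open>The direction \<open>pi/2\<close> removes the shear; after that
      \<open>pi/4\<close> removes the dilation.\<close>
    have snd: "snd (\<Psi> g) = 0"
      using ray[of "pi/2"] by (simp add: act_def colp exp_z)
    have "exp (- 2 * Re z) = 1"
      using ray[of "pi/4"] by (simp add: act_def colp exp_z snd cos_45 sin_45)
    then have "z = 0" using im by (simp add: complex_eq_iff)
    then have "\<Psi> g = \<Psi> \<one>" using snd by (simp add: z_def \<Psi>(4) prod_eq_iff)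
    then show ?thesis using inj_onD[OF \<Psi>(3)] g by blast
  qed
  ultimately show ?thesis by (rule that)
qed

text \<open>After applying \<open>cis\<close>, the laws are those of the linear action. Uniqueness
  of lifts carries them to the line, compared at 0 for the unit and at
  \<open>(\<one>,\<one>,0)\<close> for the product law.\<close>

lemma line_action_exists:
  "\<exists>F. monotone_action (top_of_set (carrier G)) (\<otimes>) (m_inv G) F \<and>
    (\<forall>g\<in>carrier G. \<forall>h\<in>carrier G. (\<forall>t. F g t = F h t) \<longrightarrow> g = h)"
proof -
  obtain F where F: "continuous_on (carrier G \<times> UNIV) (\<lambda>(g,t). F g t)"
    "\<And>g t. g \<in> carrier G \<Longrightarrow> cis (F g t) = sgn (act (p g) (cis t))"
    "F \<one> 0 = 0"
    "\<And>g. \<lbrakk>g \<in> carrier G; \<And>t. F g t = t\<rbrakk> \<Longrightarrow> g = \<one>"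
    using lifted_circle_action by blast
  have Fcont: "continuous_on S (\<lambda>x. F (f x) (h x))"
    if "continuous_on S f" "continuous_on S h" "\<And>x. x \<in> S \<Longrightarrow> f x \<in> carrier G"
    for S :: "'x::topological_space set" and f h
    using continuous_on_compose2[OF F(1) continuous_on_Pair[OF that(1,2)]] that(3) by auto
  have F_one: "F \<one> t = t" for t
    by (rule equal_of_cis_equal[of UNIV "F \<one>" "\<lambda>t. t" 0 t])
      (auto intro!: Fcont simp: F p_one act_one sgn_cis)
  have F_mult: "F (g \<otimes> h) t = F g (F h t)" if "g \<in> carrier G" "h \<in> carrier G" for g h t
  proof -
    let ?S = "carrier G \<times> carrier G \<times> (UNIV :: real set)"
    have "(\<lambda>(g,h,t). F (g \<otimes> h) t) (g,h,t) = (\<lambda>(g,h,t). F g (F h t)) (g,h,t)"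
    proof (rule equal_of_cis_equal[of ?S])
      show "connected ?S" by (intro connected_Times connected_carrier) simp
      show "continuous_on ?S (\<lambda>(g,h,t). F (g \<otimes> h) t)" "continuous_on ?S (\<lambda>(g,h,t). F g (F h t))"
        unfolding case_prod_unfold
        by (intro Fcont continuous_on_mult continuous_intros; auto)+
      show "cis ((\<lambda>(g,h,t). F (g \<otimes> h) t) z) = cis ((\<lambda>(g,h,t). F g (F h t)) z)" if "z \<in> ?S" for z
        using that by (auto simp: F(2) p_mult act_mult sgn_act_sgn)
      show "(\<one>,\<one>,0) \<in> ?S" "(g,h,t) \<in> ?S" using that by auto
      show "(\<lambda>(g,h,t). F (g \<otimes> h) t) (\<one>,\<one>,0) = (\<lambda>(g,h,t). F g (F h t)) (\<one>,\<one>,0)"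
        using F(3) by simp
    qed
    then show ?thesis by simp
  qed
  have F_inv: "F g (F (inv g) t) = t" "F (inv g) (F g t) = t" if "g \<in> carrier G" for g t
    using that F_mult[of g "inv g" t] F_mult[of "inv g" g t] F_one by auto
  have orbit: "continuous_map (top_of_set (carrier G)) euclideanreal (\<lambda>g. F g t)" for t
    by (auto intro!: Fcont continuous_intros)
  have "strict_mono (F g)" if "g \<in> carrier G" for g
  proof (rule strict_mono_by_connectedness[OF _ _ F_one orbit])
    show "connected_space (top_of_set (carrier G))"
      using connected_carrier connectedin_def connectedin_iff_connected by blast
    show "inj (F h)" if "h \<in> topspace (top_of_set (carrier G))" for h
      using that F_inv(2)[of h] by (auto intro: inj_on_inverseI)
  qed (use that in auto)
  then have "monotone_action (top_of_set (carrier G)) (\<otimes>) (m_inv G) F"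
    using F_mult F_inv orbit by (auto simp: monotone_action_def)
  moreover have "g = h" if "g \<in> carrier G" "h \<in> carrier G" "\<And>t. F g t = F h t" for g h
  proof -
    have "F (inv h \<otimes> g) t = t" for t using that F_mult F_inv by simp
    then have "inv h \<otimes> g = \<one>" using that F(4) by simp
    then show ?thesis using that by (metis inv_closed inv_equality inv_inv)
  qed
  ultimately show ?thesis by blast
qed

end

subsection \<open>The product group\<close>

text \<open>Determinant 1 makes the diagonal entries of a triangular matrix nonzero, so the upper
  left one keeps its sign on the component. Conversely, the matrices where it is positive are a
  continuous image of the plane.\<close>

lemma ST2_0_eq: "ST2_0 = {A. det A = 1 \<and> A $ 2 $ 1 = 0 \<and> A $ 1 $ 1 > 0}"
proof
  have "A $ 1 $ 1 > 0" if A: "A \<in> ST2_0" for A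
  proof (rule ccontr)
    assume "\<not> A $ 1 $ 1 > 0"
    have "connected ((\<lambda>A. A $ 1 $ 1) ` ST2_0)"
      unfolding ST2_0_def by (intro connected_continuous_image continuous_intros) simp
    moreover have "mat 1 \<in> ST2_0" by (simp add: ST2_0_def ST2_def)
    then have "(mat 1 :: real^2^2) $ 1 $ 1 \<in> (\<lambda>A. A $ 1 $ 1) ` ST2_0" by blast
    ultimately have "0 \<in> (\<lambda>A. A $ 1 $ 1) ` ST2_0"
      using connected_contains_Icc[of "(\<lambda>A. A $ 1 $ 1) ` ST2_0" "A $ 1 $ 1" 1] A
        \<open>\<not> A $ 1 $ 1 > 0\<close> by (auto simp: subset_iff)
    then obtain B where "B \<in> ST2_0" "B $ 1 $ 1 = 0" by auto
    then show False
      using connected_component_subset[of ST2 "mat 1"] by (auto simp: ST2_0_def ST2_def det_2)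
  qed
  then show "ST2_0 \<subseteq> {A. det A = 1 \<and> A $ 2 $ 1 = 0 \<and> A $ 1 $ 1 > 0}"
    using connected_component_subset[of ST2 "mat 1"] by (auto simp: ST2_0_def ST2_def)
next
  let ?f = "\<lambda>x. mat2 (exp (fst x)) (snd x) 0 (exp (- fst x))"
  have "range ?f \<subseteq> ST2_0"
    unfolding ST2_0_def
  proof (rule connected_component_maximal)
    show "mat 1 \<in> range ?f" by (rule range_eqI[of _ _ "(0,0)"]) (simp add: mat2_eq_iff)
    show "connected (range ?f)" by (intro connected_continuous_image continuous_intros) auto
    show "range ?f \<subseteq> ST2" by (auto simp: ST2_def det_2 simp flip: exp_add)
  qed
  moreover have "A \<in> range ?f" if "det A = 1" "A $ 2 $ 1 = 0" "A $ 1 $ 1 > 0" for A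
    using that
    by (intro range_eqI[of _ _ "(ln (A $ 1 $ 1), A $ 1 $ 2)"])
      (simp add: mat2_eq_iff det_2 exp_minus field_simps)
  ultimately show "{A. det A = 1 \<and> A $ 2 $ 1 = 0 \<and> A $ 1 $ 1 > 0} \<subseteq> ST2_0" by blast
qed

lemma ST2_0_entries:
  assumes "A \<in> ST2_0"
  shows "A $ 1 $ 1 > 0" "A $ 2 $ 2 > 0" "A $ 2 $ 2 = inverse (A $ 1 $ 1)" "A $ 2 $ 1 = 0"
proof -
  have A: "A $ 1 $ 1 > 0" "A $ 1 $ 1 * A $ 2 $ 2 = 1" "A $ 2 $ 1 = 0"
    using assms by (auto simp: ST2_0_eq det_2)
  then show "A $ 1 $ 1 > 0" "A $ 2 $ 1 = 0" by blast+
  show inv: "A $ 2 $ 2 = inverse (A $ 1 $ 1)" using inverse_unique[OF A(2)] by (rule sym)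
  then show "A $ 2 $ 2 > 0" using A(1) by (metis positive_imp_inverse_positive)
qed

lemma ST2_0_mult: "\<lbrakk>A \<in> ST2_0; B \<in> ST2_0\<rbrakk> \<Longrightarrow> A ** B \<in> ST2_0"
  by (auto simp: ST2_0_eq det_mul)

definition ST_inv :: "real^2^2 \<Rightarrow> real^2^2" where
  "ST_inv A = mat2 (A $ 2 $ 2) (- A $ 1 $ 2) 0 (A $ 1 $ 1)"

text \<open>The Moebius action on the line; upper triangular matrices fix infinity.\<close>

definition affine_action :: "real^2^2 \<Rightarrow> real \<Rightarrow> real" where
  "affine_action A t = (A $ 1 $ 1 * t + A $ 1 $ 2) / A $ 2 $ 2"

lemma affine_action_ST2_0:
  assumes "A \<in> ST2_0"
  shows "affine_action A t = (A $ 1 $ 1)\<^sup>2 * t + A $ 1 $ 1 * A $ 1 $ 2"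
  unfolding affine_action_def ST2_0_entries(3)[OF assms] divide_inverse inverse_inverse_eq
  by (simp add: power2_eq_square algebra_simps)

lemma ST_inv_closed:
  assumes "A \<in> ST2_0"
  shows "ST_inv A \<in> ST2_0"
proof -
  have "A $ 1 $ 1 * A $ 2 $ 2 = 1" using assms by (auto simp: ST2_0_eq det_2)
  then show ?thesis
    using ST2_0_entries(2)[OF assms] by (simp add: ST2_0_eq ST_inv_def det_2 mult.commute)
qed

lemma monotone_action_affine: "monotone_action (top_of_set ST2_0) (**) ST_inv affine_action"
proof -
  have "affine_action (A ** B) t = affine_action A (affine_action B t)"
    if "A \<in> ST2_0" "B \<in> ST2_0" for A B t
  proof -
    have "A $ 2 $ 2 \<noteq> 0" "B $ 2 $ 2 \<noteq> 0" "A $ 2 $ 1 = 0" "B $ 2 $ 1 = 0"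
      using ST2_0_entries(2,4)[OF that(1)] ST2_0_entries(2,4)[OF that(2)] by simp_all
    then show ?thesis by (simp add: affine_action_def field_simps)
  qed
  moreover have "affine_action A (affine_action (ST_inv A) t) = t \<and>
      affine_action (ST_inv A) (affine_action A t) = t" if "A \<in> ST2_0" for A t
    using ST2_0_entries(1,2)[OF that] by (simp add: affine_action_def ST_inv_def field_simps)
  moreover have "continuous_on ST2_0 (\<lambda>A. affine_action A t)" for t
  proof -
    have "continuous_on ST2_0 (\<lambda>A. (A $ 1 $ 1)\<^sup>2 * t + A $ 1 $ 1 * A $ 1 $ 2)"
      by (intro continuous_intros)
    then show ?thesis by (simp add: affine_action_ST2_0 cong: continuous_on_cong)
  qed
  moreover have "strict_mono (affine_action A)" if "A \<in> ST2_0" for A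
    using ST2_0_entries(1)[OF that] by (intro strict_monoI) (simp add: affine_action_ST2_0 that)
  ultimately show ?thesis
    using ST_inv_closed by (auto simp: monotone_action_def)
qed

text \<open>The images of 0 and 1 determine the square of the upper left entry, and positivity its
  sign. The matrix \<open>- mat 1\<close>, which acts trivially, lies outside the identity
  component.\<close>

lemma affine_action_faithful:
  assumes "A \<in> ST2_0" "B \<in> ST2_0" "\<And>t. affine_action A t = affine_action B t"
  shows "A = B"
proof -
  have *: "(A $ 1 $ 1)\<^sup>2 * t + A $ 1 $ 1 * A $ 1 $ 2 = (B $ 1 $ 1)\<^sup>2 * t + B $ 1 $ 1 * B $ 1 $ 2" for t
    using assms(3)[of t] unfolding affine_action_ST2_0[OF assms(1)] affine_action_ST2_0[OF assms(2)] .
  have 11: "A $ 1 $ 1 = B $ 1 $ 1"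
    using *[of 0] *[of 1] ST2_0_entries(1)[OF assms(1)] ST2_0_entries(1)[OF assms(2)]
    by (simp add: power2_eq_iff)
  then show ?thesis
    using *[of 0] ST2_0_entries(1,3,4)[OF assms(1)] ST2_0_entries(1,3,4)[OF assms(2)]
    by (simp add: mat2_eq_iff)
qed

lemma monotone_action_translation: "monotone_action euclideanreal (+) uminus (+)"
  by (auto simp: monotone_action_def strict_mono_def intro!: continuous_intros)

text \<open>Makes the action of one factor an action of the whole product along the projection;
  faithfulness is recovered only by combining all factors.\<close>

lemma monotone_action_pullback:
  assumes "monotone_action T mul \<nu> F" and \<pi>: "continuous_map T' T \<pi>"
    and "\<And>x y. \<lbrakk>x \<in> topspace T'; y \<in> topspace T'\<rbrakk> \<Longrightarrow> \<pi> (mul' x y) = mul (\<pi> x) (\<pi> y)"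
    and "\<And>x. x \<in> topspace T' \<Longrightarrow> \<nu>' x \<in> topspace T' \<and> \<pi> (\<nu>' x) = \<nu> (\<pi> x)"
  shows "monotone_action T' mul' \<nu>' (\<lambda>x. F (\<pi> x))"
proof -
  have \<pi>T: "\<pi> x \<in> topspace T" if "x \<in> topspace T'" for x
    using continuous_map_image_subset_topspace[OF \<pi>] that by blast
  have "continuous_map T' euclideanreal (\<lambda>x. F (\<pi> x) t)" for t
    using continuous_map_compose[OF \<pi> monotone_action_orbit[OF assms(1), of t]] by (simp add: o_def)
  then show ?thesis
    using assms \<pi>T by (simp add: monotone_action_def)
qed

lemma topspace_prod_topo: "topspace (prod_topo G j k m) = prod_carrier G j k m"
  by (simp add: prod_topo_def prod_carrier_def)

lemma prod_topo_projections:
  "i < j \<Longrightarrow> continuous_map (prod_topo G j k m) (top_of_set (carrier G)) (\<lambda>x. fst x i)"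
  "i < k \<Longrightarrow> continuous_map (prod_topo G j k m) (top_of_set ST2_0) (\<lambda>x. fst (snd x) i)"
  "i < m \<Longrightarrow> continuous_map (prod_topo G j k m) euclideanreal (\<lambda>x. snd (snd x) i)"
proof -
  note fst = continuous_map_fst and snd = continuous_map_snd
  note comp = continuous_map_compose[unfolded o_def]
  show "i < j \<Longrightarrow> continuous_map (prod_topo G j k m) (top_of_set (carrier G)) (\<lambda>x. fst x i)"
    unfolding prod_topo_def
    by (rule comp[OF fst]) (rule continuous_map_product_projection, simp)
  show "i < k \<Longrightarrow> continuous_map (prod_topo G j k m) (top_of_set ST2_0) (\<lambda>x. fst (snd x) i)"
    unfolding prod_topo_def
    by (rule comp[OF comp[OF snd fst]]) (rule continuous_map_product_projection, simp)
  show "i < m \<Longrightarrow> continuous_map (prod_topo G j k m) euclideanreal (\<lambda>x. snd (snd x) i)"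
    unfolding prod_topo_def
    by (rule comp[OF comp[OF snd snd]]) (rule continuous_map_product_projection, simp)
qed

theorem mainTheorem3:
  fixes G :: "('g::topological_space) monoid" and p :: "'g \<Rightarrow> real^2^2"
    and X :: "'a topology" and j k m n :: nat
  assumes "is_universal_cover_SL2 G p"
    and "manifold_of_dim X n" and "n \<ge> 1"
    and "connected_space X" and "topspace X \<noteq> {}"
  shows "\<exists>\<alpha>. effective_action (prod_carrier G j k m) (prod_mult G j k m) (prod_topo G j k m) X \<alpha>"
proof -
  interpret SL2_cover G p by unfold_locales (rule assms(1))
  let ?T = "prod_topo G j k m" and ?mul = "prod_mult G j k m" and ?N = "j + k + m"
  obtain F where F: "monotone_action (top_of_set (carrier G)) (mult G) (m_inv G) F"
      "\<And>g h. \<lbrakk>g \<in> carrier G; h \<in> carrier G; \<And>t. F g t = F h t\<rbrakk> \<Longrightarrow> g = h"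
    using line_action_exists by blast
  define \<nu> where "\<nu> x = (\<lambda>i\<in>{..<j}. m_inv G (fst x i), \<lambda>i\<in>{..<k}. ST_inv (fst (snd x) i),
      \<lambda>i\<in>{..<m}. - snd (snd x) i)" for x :: "'g prodelt"
  \<comment> \<open>The indices fall into consecutive ranges of lengths \<open>j\<close>,
    \<open>k\<close> and \<open>m\<close>, one for each kind of factor.\<close>
  define A where "A i x = (if i < j then on_unit_interval F (fst x i)
      else if i < j + k then on_unit_interval affine_action (fst (snd x) (i - j))
      else on_unit_interval (+) (snd (snd x) (i - j - k)))" for i and x :: "'g prodelt"
  have \<nu>: "\<nu> x \<in> topspace ?T" if "x \<in> topspace ?T" for x
    using that
    by (auto simp: topspace_prod_topo prod_carrier_def \<nu>_def
        intro!: inv_closed ST_inv_closed intro: PiE_mem)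
  have mul: "?mul x y \<in> topspace ?T" if "x \<in> topspace ?T" "y \<in> topspace ?T" for x y
    using that
    by (auto simp: topspace_prod_topo prod_carrier_def prod_mult_def
        intro!: m_closed ST2_0_mult intro: PiE_mem)
  have comps: "i < j \<Longrightarrow> fst (?mul x y) i = fst x i \<otimes>\<^bsub>G\<^esub> fst y i"
      "i < k \<Longrightarrow> fst (snd (?mul x y)) i = fst (snd x) i ** fst (snd y) i"
      "i < m \<Longrightarrow> snd (snd (?mul x y)) i = snd (snd x) i + snd (snd y) i"
      "i < j \<Longrightarrow> fst (\<nu> x) i = inv\<^bsub>G\<^esub> (fst x i)"
      "i < k \<Longrightarrow> fst (snd (\<nu> x)) i = ST_inv (fst (snd x) i)"
      "i < m \<Longrightarrow> snd (snd (\<nu> x)) i = - snd (snd x) i" for i x y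
    by (simp_all add: prod_mult_def \<nu>_def case_prod_unfold)
  have A: "monotone_action ?T ?mul \<nu> (A i)" if "i < ?N" for i
  proof -
    consider (G) "i < j" | (ST) "\<not> i < j" "i < j + k" | (R) "\<not> i < j" "\<not> i < j + k"
      by blast
    then show ?thesis
    proof cases
      case G
      have "monotone_action ?T ?mul \<nu> (\<lambda>x. on_unit_interval F (fst x i))"
        by (rule monotone_action_pullback[OF monotone_action_on_unit_interval[OF F(1)]
              prod_topo_projections(1)[OF G]])
          (use G in \<open>simp_all add: \<nu> comps\<close>)
      moreover have "A i = (\<lambda>x. on_unit_interval F (fst x i))"
        using G by (simp add: A_def fun_eq_iff)
      ultimately show ?thesis by simp
    next
      case ST
      then have i: "i - j < k" by linarith
      have "monotone_action ?T ?mul \<nu> (\<lambda>x. on_unit_interval affine_action (fst (snd x) (i - j)))"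
        by (rule monotone_action_pullback[OF monotone_action_on_unit_interval[OF
              monotone_action_affine] prod_topo_projections(2)[OF i]])
          (use i in \<open>simp_all add: \<nu> comps\<close>)
      moreover have "A i = (\<lambda>x. on_unit_interval affine_action (fst (snd x) (i - j)))"
        using ST by (simp add: A_def fun_eq_iff)
      ultimately show ?thesis by simp
    next
      case R
      then have i: "i - j - k < m" using that by linarith
      have "monotone_action ?T ?mul \<nu> (\<lambda>x. on_unit_interval (+) (snd (snd x) (i - j - k)))"
        by (rule monotone_action_pullback[OF monotone_action_on_unit_interval[OF
              monotone_action_translation] prod_topo_projections(3)[OF i]])
          (use i in \<open>simp_all add: \<nu> comps\<close>)
      moreover have "A i = (\<lambda>x. on_unit_interval (+) (snd (snd x) (i - j - k)))"
        using R by (simp add: A_def fun_eq_iff)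
      ultimately show ?thesis by simp
    qed
  qed
  have supp: "supported_in (topspace ?T) (A i) {0<..<1}" for i
    by (auto simp: supported_in_def A_def on_unit_interval_def)
  have faithful: "x = y"
    if xy: "x \<in> topspace ?T" "y \<in> topspace ?T" and eq: "\<And>r. stacked ?N A x r = stacked ?N A y r" for x y
  proof -
    have A_eq: "A i x s = A i y s" if "i < ?N" for i s
      using stacked_eqD[OF supp xy eq that] .
    obtain u v w where x: "x = (u, v, w)" by (cases x)
    obtain u' v' w' where y: "y = (u', v', w')" by (cases y)
    have xy': "u \<in> PiE {..<j} (\<lambda>_. carrier G)" "v \<in> PiE {..<k} (\<lambda>_. ST2_0)" "w \<in> PiE {..<m} (\<lambda>_. UNIV)"
       "u' \<in> PiE {..<j} (\<lambda>_. carrier G)" "v' \<in> PiE {..<k} (\<lambda>_. ST2_0)" "w' \<in> PiE {..<m} (\<lambda>_. UNIV)"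
      using xy by (simp_all add: topspace_prod_topo prod_carrier_def x y)
    \<comment> \<open>Functions in \<open>PiE\<close> are \<open>undefined\<close> off the index
      set, so agreement at the indices gives equality.\<close>
    have "u = u'"
    proof (rule PiE_ext[OF xy'(1,4)])
      fix i assume i: "i \<in> {..<j}"
      then have "on_unit_interval F (u i) s = on_unit_interval F (u' i) s" for s
        using A_eq[of i s] by (simp add: A_def x y)
      then have "F (u i) t = F (u' i) t" for t by (rule on_unit_interval_eqD)
      then show "u i = u' i" using F(2) i xy' by (metis PiE_mem)
    qed
    moreover have "v = v'"
    proof (rule PiE_ext[OF xy'(2,5)])
      fix i assume i: "i \<in> {..<k}"
      then have "on_unit_interval affine_action (v i) s = on_unit_interval affine_action (v' i) s" for s
        using A_eq[of "j + i" s] by (simp add: A_def x y)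
      then have "affine_action (v i) t = affine_action (v' i) t" for t by (rule on_unit_interval_eqD)
      then show "v i = v' i" using affine_action_faithful i xy' by (metis PiE_mem)
    qed
    moreover have "w = w'"
    proof (rule PiE_ext[OF xy'(3,6)])
      fix i assume i: "i \<in> {..<m}"
      then have "on_unit_interval (+) (w i) s = on_unit_interval (+) (w' i) s" for s
        using A_eq[of "j + k + i" s] by (simp add: A_def x y)
      then have "w i + t = w' i + t" for t by (rule on_unit_interval_eqD)
      then show "w i = w' i" by simp
    qed
    ultimately show ?thesis by (simp add: x y)
  qed
  have "\<exists>\<alpha>. effective_action (topspace ?T) ?mul ?T X \<alpha>"
  \<comment> \<open>The last block ends at \<open>1 + real ?N\<close>; with no factors this is 1,
    still admissible for \<open>M\<close>.\<close>
  proof (rule effective_action_on_manifold[OF assms(2,3,5), where \<nu> = \<nu> and \<Phi> = "stacked ?N A"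
        and M = "1 + real ?N"])
    show "stacked ?N A (?mul x y) r = stacked ?N A x (stacked ?N A y r)"
      if "x \<in> topspace ?T" "y \<in> topspace ?T" for x y r
      using A supp that mul[OF that] by (rule stacked_mult)
    show "stacked ?N A x (stacked ?N A (\<nu> x) r) = r \<and> stacked ?N A (\<nu> x) (stacked ?N A x r) = r"
      if "x \<in> topspace ?T" for x r
      using A supp that \<nu>[OF that] by (rule stacked_inv)
    show "continuous_map (prod_topology ?T euclideanreal) euclideanreal (\<lambda>(x,r). stacked ?N A x r)"
      using A by (rule stacked_jointly_continuous)
    show "stacked ?N A x r = r" if "x \<in> topspace ?T" "r \<le> 1 \<or> 1 + real ?N \<le> r" for x r
      using supp that by (rule stacked_outside)
    show "\<exists>r. stacked ?N A x r \<noteq> stacked ?N A y r"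
      if "x \<in> topspace ?T" "y \<in> topspace ?T" "x \<noteq> y" for x y
      using faithful that by blast
  qed (use \<nu> in auto)
  then show ?thesis by (simp add: topspace_prod_topo)
qed

end
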